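(* Let $G=(V,E,w)$ be a connected hypergraph with $V=\{v_1,\dots,v_{n+m}\}$, let $p\in[1,\infty)$, $T\in(0,\infty)$, and let $a=(0,\dots,0,a_1,\dots,a_m)\in W^{1,2}(0,T;\mathbb{R}^V)$ (first $n$ components zero). Then for any $x_0\in K_a(0)$ and any $h\in L^2(0,T;\mathbb{R}^V)$, the Cauchy problem $$x'(t)+\partial\varphi(x(t))+\partial I_{K_a(t)}(x(t))\ni h(t)\quad (t\in[0,T]),\qquad x(0)=x_0,$$ possesses a unique solution $x\in W^{1,2}(0,T;\mathbb{R}^V)$.
   Context: Hypergraph: $n,m\ge 1$ are integers, $V=\{v_1,\dots,v_n,v_{n+1},\dots,v_{n+m}\}$ is a finite set with $n+m$ elements, $E\subset 2^V$ is a family of subsets of $V$ each having at least two elements, and $w:E\to(0,\infty)$. The triplet $G=(V,E,w)$ is called a hypergraph. $G$ is connected if for all $u,v\in V$ there exist $u_1,\dots,u_{N-1}\in V$ and $e_1,\dots,e_N\in E$ with $u_{j-1},u_j\in e_j$ for $j=1,\dots,N$, where $u_0=u$, $u_N=v$. $\mathbb{R}^V$ is the set of maps $x:V\to\mathbb{R}$, identified with $\mathbb{R}^{n+m}$ via $x_i=x(v_i)$, with standard inner product $x\cdot y$ and Euclidean norm $\|x\|$. Energy: $f_e(x)=\max_{u,v\in e}(x(u)-x(v))$ for $e\in E$, and $\varphi(x)=\frac1p\sum_{e\in E}w(e)(f_e(x))^p$. Subdifferential: for a proper lower semicontinuous convex $\psi:\mathbb{R}^V\to(-\infty,+\infty]$,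 $\partial\psi(x)=\{\eta\in\mathbb{R}^V:\ \eta\cdot(z-x)\le\psi(z)-\psi(x)\ \forall z\in\mathbb{R}^V\}$ if $\psi(x)<\infty$, and $\partial\psi(x)=\varnothing$ otherwise. Constraint: $K_a(t)=\{x\in\mathbb{R}^V:\ x=(x_1,\dots,x_n,a_1(t),\dots,a_m(t)),\ x_i\in\mathbb{R}\ (i=1,\dots,n)\}$, and $I_{K_a(t)}$ is its indicator function ($0$ on $K_a(t)$, $+\infty$ elsewhere). $W^{1,2}(0,T;\mathbb{R}^V)$ is the set of functions that belong to $L^2(0,T;\mathbb{R}^V)$ together with their derivative; its elements are identified with their (absolutely) continuous representatives on $[0,T]$. A solution is a function $x\in W^{1,2}(0,T;\mathbb{R}^V)$ with $x(0)=x_0$ for which the inclusion holds for a.e. $t\in[0,T]$, i.e. there are $\eta(t)\in\partial\varphi(x(t))$ and $\xi(t)\in\partial I_{K_a(t)}(x(t))$ with $x'(t)+\eta(t)+\xi(t)=h(t)$ for a.e. $t$. *)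

theory Defs
  imports "HOL-Analysis.Analysis"
begin

text \<open>
  The vertex set is a finite type \<open>'v\<close>. An edge family is a set of subsets of \<open>'v\<close>; only the
  values of the weight on the edges matter.
\<close>

definition hypergraph :: "'v::finite set set \<Rightarrow> ('v set \<Rightarrow> real) \<Rightarrow> bool" where
  "hypergraph E w \<longleftrightarrow> (\<forall>e\<in>E. card e \<ge> 2 \<and> w e > 0)"

definition connected_hypergraph :: "'v::finite set set \<Rightarrow> bool" where
  "connected_hypergraph E \<longleftrightarrow>
     (\<forall>u v. \<exists>(N::nat) (us :: nat \<Rightarrow> 'v) (es :: nat \<Rightarrow> 'v set).
        N \<ge> 1 \<and> us 0 = u \<and> us N = v \<and>
        (\<forall>j\<in>{1..N}. es j \<in> E \<and> us (j - 1) \<in> es j \<and> us j \<in> es j))"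

definition edge_max :: "'v::finite set \<Rightarrow> real ^ 'v \<Rightarrow> real" where
  "edge_max e x = Max {x $ u - x $ v | u v. u \<in> e \<and> v \<in> e}"

definition energy :: "real \<Rightarrow> 'v::finite set set \<Rightarrow> ('v set \<Rightarrow> real) \<Rightarrow> real ^ 'v \<Rightarrow> real" where
  "energy p E w x = (1 / p) * (\<Sum>e\<in>E. w e * edge_max e x powr p)"

text \<open>
  Meant for functions that never take the value \<open>- \<infinity>\<close>, so that the difference below is never of
  the form \<open>\<infinity> - \<infinity>\<close>.
\<close>

definition subdifferential :: "('a::real_inner \<Rightarrow> ereal) \<Rightarrow> 'a \<Rightarrow> 'a set" where
  "subdifferential \<psi> x =
     (if \<psi> x < \<infinity> then {\<eta>. \<forall>z. ereal (\<eta> \<bullet> (z - x)) \<le> \<psi> z - \<psi> x} else {})"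

definition convex_indicator :: "'a set \<Rightarrow> 'a \<Rightarrow> ereal" where
  "convex_indicator K x = (if x \<in> K then 0 else \<infinity>)"

text \<open>
  The vertices are split as \<open>'n + 'm\<close>: \<open>Inl i\<close> are the \<open>n = CARD('n)\<close> free vertices and \<open>Inr j\<close> the
  \<open>m = CARD('m)\<close> vertices at which the value is prescribed (both numbers are positive, as types
  are nonempty).
\<close>

definition constraint_set ::
    "(real \<Rightarrow> real ^ ('n::finite + 'm::finite)) \<Rightarrow> real \<Rightarrow> (real ^ ('n + 'm)) set" where
  "constraint_set a t = {x. \<forall>j. x $ Inr j = a t $ Inr j}"

definition L2_space :: "real \<Rightarrow> (real \<Rightarrow> 'a::euclidean_space) set" where
  "L2_space T = {f. f \<in> borel_measurable (lebesgue_on {0<..<T}) \<and>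
                    integrable (lebesgue_on {0<..<T}) (\<lambda>t. (norm (f t))\<^sup>2)}"

text \<open>
  \<open>\<theta>\<close> is continuously differentiable with derivative \<open>\<theta>'\<close> and has compact support in \<open>(0,T)\<close>.
\<close>

definition test_function :: "real \<Rightarrow> (real \<Rightarrow> real) \<Rightarrow> (real \<Rightarrow> real) \<Rightarrow> bool" where
  "test_function T \<theta> \<theta>' \<longleftrightarrow>
     (\<forall>t. (\<theta> has_real_derivative \<theta>' t) (at t)) \<and> continuous_on UNIV \<theta>' \<and>
     (\<exists>c d. 0 < c \<and> d < T \<and> (\<forall>t. t \<notin> {c..d} \<longrightarrow> \<theta> t = 0))"

definition weak_derivative ::
    "real \<Rightarrow> (real \<Rightarrow> 'a::euclidean_space) \<Rightarrow> (real \<Rightarrow> 'a) \<Rightarrow> bool" where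
  "weak_derivative T x x' \<longleftrightarrow>
     (\<forall>\<theta> \<theta>'. test_function T \<theta> \<theta>' \<longrightarrow>
        (LINT t|lebesgue_on {0<..<T}. \<theta>' t *\<^sub>R x t) =
        - (LINT t|lebesgue_on {0<..<T}. \<theta> t *\<^sub>R x' t))"

text \<open>
  Elements are functions, not equivalence classes: the continuity condition selects the
  continuous representative on \<open>[0,T]\<close>. Values outside \<open>[0,T]\<close> are irrelevant.
\<close>

definition W12_space :: "real \<Rightarrow> (real \<Rightarrow> 'a::euclidean_space) set" where
  "W12_space T = {x \<in> L2_space T. continuous_on {0..T} x \<and>
                    (\<exists>x'\<in>L2_space T. weak_derivative T x x')}"

text \<open>
  The derivative \<open>x'\<close> is only determined almost everywhere, which does not affect the
  almost-everywhere inclusion.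
\<close>

definition is_solution ::
    "real \<Rightarrow> ('n::finite + 'm::finite) set set \<Rightarrow> (('n + 'm) set \<Rightarrow> real) \<Rightarrow> real \<Rightarrow>
     (real \<Rightarrow> real ^ ('n + 'm)) \<Rightarrow> (real \<Rightarrow> real ^ ('n + 'm)) \<Rightarrow> real ^ ('n + 'm) \<Rightarrow>
     (real \<Rightarrow> real ^ ('n + 'm)) \<Rightarrow> bool" where
  "is_solution p E w T a h x0 x \<longleftrightarrow>
     x \<in> W12_space T \<and> x 0 = x0 \<and>
     (\<exists>x'\<in>L2_space T. weak_derivative T x x' \<and>
        (AE t in lebesgue_on {0..T}.
           \<exists>\<eta>\<in>subdifferential (\<lambda>z. ereal (energy p E w z)) (x t).
           \<exists>\<xi>\<in>subdifferential (convex_indicator (constraint_set a t)) (x t).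
             x' t + \<eta> + \<xi> = h t))"

end

theory Submission
  imports Defs "HOL-Complex_Analysis.Great_Picard"
begin

text \<open>
  Existence and uniqueness for the constrained gradient flow of the hypergraph energy \<open>\<phi>\<close>.
  
  Let \<open>\<pi>\<close> be the orthogonal projection onto the free components. A vector is normal to the constraint set
  at one of its points exactly if \<open>\<pi>\<close> annihilates it, so the inclusion says that \<open>u = x - a\<close> stays in
  the range of \<open>\<pi>\<close> and solves \<open>u' = \<pi> (h - \<eta>)\<close> with \<open>\<eta> t \<in> \<partial>\<phi> (x t)\<close> almost everywhere.
  
  Uniqueness is monotonicity. The difference \<open>d\<close> of two solutions has \<open>d \<bullet> d' \<le> 0\<close> almost everywhere,
  and \<open>|d|\<^sup>2\<close> is the primitive of \<open>2 d \<bullet> d'\<close>. The latter needs that a continuous function with an integrable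
  weak derivative is its primitive (\<open>weak_derivative_imp_primitive\<close>, by the lemma of du Bois-Reymond), and
  integration by parts for such primitives (\<open>integral_by_parts_absolutely_integrable\<close>, by Fubini).
  
  Existence uses that the dimension is finite. The energy has an explicit subgradient \<open>\<sigma> x\<close> at every point,
  bounded on balls (\<open>energy_subgradient\<close>). Composed with the radial retraction onto a ball of radius \<open>R\<close> it is
  a bounded, discontinuous field \<open>F\<close>. In the equation
  \<open>x t = a t + (x0 - a 0) + \<integral> \<pi> h - \<pi> (H t)\<close> the unknown \<open>H\<close>, the integral of \<open>\<eta>\<close>, is
  approximated by Euler polygons driven by \<open>F\<close>. They are equi-Lipschitz, and by Arzela-Ascoli a subsequence
  converges uniformly (\<open>Euler_limit\<close>). The limit is Lipschitz, hence the primitive of a bounded function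
  \<open>\<eta>\<close> that is its right derivative off a null set (\<open>Lipschitz_right_density\<close>). The subgradient inequalities
  are half-space conditions on \<open>\<eta>\<close> and survive the passage from polygons to the limit and from difference
  quotients to the derivative, so \<open>\<eta>\<close> is a subgradient at the retracted solution
  (\<open>truncated_inclusion\<close>). An a priori bound independent of \<open>R\<close> finally shows that for large \<open>R\<close> the solution
  stays in the ball and the retraction does nothing (\<open>gradient_flow_exists\<close>).
\<close>

section \<open>Integration by parts for primitives\<close>

lemma integrable_lebesgue_on_indicator:
  fixes f :: "real \<Rightarrow> 'a::euclidean_space"
  assumes f: "integrable (lebesgue_on S) f" and A: "A \<in> sets borel" and S: "S \<in> sets lebesgue"
  shows "integrable (lebesgue_on S) (\<lambda>s. indicator A s *\<^sub>R f s)"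
proof (rule Bochner_Integration.integrable_cong[THEN iffD1, OF refl])
  show "integrable (lebesgue_on S) (\<lambda>s. indicator (A \<inter> S) s *\<^sub>R f s)"
    using A S by (intro integrable_mult_indicator f) (auto simp: sets_restrict_space)
qed (auto simp: indicator_def)

lemma borel_measurable_bounded_bilinear:
  fixes prod :: "'a::euclidean_space \<Rightarrow> 'b::euclidean_space \<Rightarrow> 'c::euclidean_space"
  assumes "bounded_bilinear prod" "f \<in> borel_measurable N" "g \<in> borel_measurable N"
  shows "(\<lambda>x. prod (f x) (g x)) \<in> borel_measurable N"
  using assms(2,3)
  by (rule borel_measurable_continuous_Pair)
     (intro bounded_bilinear.continuous_on[OF assms(1)] continuous_intros)

lemma integral_upto_eq_LINT:
  fixes f :: "real \<Rightarrow> 'a::euclidean_space"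
  assumes f: "f absolutely_integrable_on {0..T}" and t: "t \<in> {0..T}"
  shows "integral {0..t} f = (LINT s|lebesgue_on {0..T}. indicator {..t} s *\<^sub>R f s)"
proof -
  have "integrable (lebesgue_on {0..T}) f"
    using f by (simp add: set_integrable_def integrable_restrict_space)
  then have "integrable (lebesgue_on {0..T}) (\<lambda>s. indicator {..t} s *\<^sub>R f s)"
    by (rule integrable_lebesgue_on_indicator) auto
  then have "(LINT s|lebesgue_on {0..T}. indicator {..t} s *\<^sub>R f s)
      = integral {0..T} (\<lambda>s. indicator {..t} s *\<^sub>R f s)"
    by (rule lebesgue_integral_eq_integral) auto
  also have "\<dots> = integral {0..T} (\<lambda>s. if s \<in> {..t} then f s else 0)"
    by (intro integral_cong) (auto simp: indicator_def)
  also have "\<dots> = integral ({0..t}) f"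
    using t by (simp only: integral_restrict_Int) (rule arg_cong[where f="\<lambda>A. integral A f"], auto)
  finally show ?thesis by simp
qed

text \<open>
  Integration by parts for two primitives of integrable functions, in a form that covers both the
  inner product and scalar multiplication. It is Fubini's theorem for \<open>prod (f s) (g r)\<close> on the
  triangle \<open>s \<le> r\<close>.
\<close>

lemma integral_by_parts_absolutely_integrable:
  fixes f :: "real \<Rightarrow> 'a::euclidean_space" and g :: "real \<Rightarrow> 'b::euclidean_space"
    and prod :: "'a \<Rightarrow> 'b \<Rightarrow> 'c::euclidean_space"
  assumes bb: "bounded_bilinear prod"
    and f: "f absolutely_integrable_on {0..T}" and g: "g absolutely_integrable_on {0..T}"
  shows "(\<lambda>t. prod (integral {0..t} f) (g t)) absolutely_integrable_on {0..T}" (is ?A)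
    and "(\<lambda>t. prod (f t) (integral {0..t} g)) absolutely_integrable_on {0..T}" (is ?B)
    and "prod (integral {0..T} f) (integral {0..T} g) =
      integral {0..T} (\<lambda>t. prod (integral {0..t} f) (g t)) +
      integral {0..T} (\<lambda>t. prod (f t) (integral {0..t} g))"
proof -
  interpret bounded_bilinear prod by (rule bb)
  let ?M = "lebesgue_on {0..T}"
  interpret M: finite_measure ?M
    by (rule finite_measure_lebesgue_on) auto
  interpret P: pair_sigma_finite ?M ?M ..
  have fi: "integrable ?M f" and gi: "integrable ?M g"
    using f g by (simp_all add: set_integrable_def integrable_restrict_space)
  note [measurable] = borel_measurable_integrable[OF fi] borel_measurable_integrable[OF gi]
  have bl1: "bounded_linear (\<lambda>y. prod x y)" for x by (rule bounded_linear_right)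
  have cont: "continuous_on {0..T} (\<lambda>t. integral {0..t} f)" "continuous_on {0..T} (\<lambda>t. integral {0..t} g)"
    using f g by (auto intro!: indefinite_integral_continuous_1 set_lebesgue_integral_eq_integral(1))
  have bnd: "bounded ((\<lambda>t. integral {0..t} f) ` {0..T})" "bounded ((\<lambda>t. integral {0..t} g) ` {0..T})"
    using cont by (auto intro!: compact_imp_bounded compact_continuous_image)
  have bil: "bilinear prod" by (simp add: bilinear_conv_bounded_bilinear bb)
  have bil': "bilinear (\<lambda>x y. prod y x)"
    using bb bounded_bilinear.flip bilinear_conv_bounded_bilinear by blast
  have meas: "(\<lambda>t. integral {0..t} f) \<in> borel_measurable ?M" "(\<lambda>t. integral {0..t} g) \<in> borel_measurable ?M"
    using cont by (auto intro!: continuous_imp_measurable_on_sets_lebesgue)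
  show A: ?A
    by (rule absolutely_integrable_bounded_measurable_product[OF bil meas(1) _ bnd(1) g]) auto
  show B: ?B
    by (rule absolutely_integrable_bounded_measurable_product[OF bil' meas(2) _ bnd(2) f]) auto
  obtain K where K: "\<And>a b. norm (prod a b) \<le> norm a * norm b * K" using bounded by blast
  note pm = borel_measurable_bounded_bilinear[OF bb]
  have fz: "(\<lambda>z. f (fst z)) \<in> borel_measurable (?M \<Otimes>\<^sub>M ?M)"
    and gz: "(\<lambda>z. g (snd z)) \<in> borel_measurable (?M \<Otimes>\<^sub>M ?M)"
    by (rule measurable_compose[OF measurable_fst] measurable_compose[OF measurable_snd],
        rule borel_measurable_integrable fi gi, rule fi gi)+
  have pgi: "integrable ?M (\<lambda>r. prod x (g r))" for x
    by (rule integrable_bounded_linear[OF bl1 gi])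
  have nm: "(\<lambda>z. norm (prod (f (fst z)) (g (snd z)))) \<in> borel_measurable (?M \<Otimes>\<^sub>M ?M)"
    by (rule measurable_compose[OF pm[OF fz gz] borel_measurable_norm])
  have int: "integrable (?M \<Otimes>\<^sub>M ?M) (\<lambda>(s, r). prod (f s) (g r))"
  proof (rule P.Fubini_integrable)
    show "(\<lambda>(s, r). prod (f s) (g r)) \<in> borel_measurable (?M \<Otimes>\<^sub>M ?M)"
      unfolding case_prod_unfold by (rule pm[OF fz gz])
    have gn: "integrable ?M (\<lambda>r. norm (prod (f s) (g r)))" for s
      using pgi by (rule integrable_norm)
    show "integrable ?M (\<lambda>s. LINT r|?M. norm (case (s, r) of (s, r) \<Rightarrow> prod (f s) (g r)))"
    proof (rule Bochner_Integration.integrable_bound)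
      show "integrable ?M (\<lambda>s. norm (f s) * ((LINT r|?M. norm (g r)) * K))"
        using fi by (intro integrable_mult_left integrable_norm)
      show "(\<lambda>s. LINT r|?M. norm (case (s, r) of (s, r) \<Rightarrow> prod (f s) (g r))) \<in> borel_measurable ?M"
        using M.borel_measurable_lebesgue_integral[of "\<lambda>s r. norm (prod (f s) (g r))" ?M] nm
        by (simp add: case_prod_unfold)
      have "(LINT r|?M. norm (prod (f s) (g r))) \<le> (LINT r|?M. norm (f s) * norm (g r) * K)" for s
        by (rule integral_mono[OF gn _ K]) (intro integrable_mult_left integrable_mult_right integrable_norm gi)
      also have "(LINT r|?M. norm (f s) * norm (g r) * K) = norm (f s) * ((LINT r|?M. norm (g r)) * K)" for s
        by (simp add: mult.assoc)
      finally have le: "(LINT r|?M. norm (prod (f s) (g r))) \<le> norm (f s) * ((LINT r|?M. norm (g r)) * K)" for s .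
      have "norm (LINT r|?M. norm (prod (f s) (g r))) \<le> norm (norm (f s) * ((LINT r|?M. norm (g r)) * K))" for s
        using order_trans[OF le[of s] abs_ge_self] by simp
      then show "AE s in ?M. norm (LINT r|?M. norm (case (s, r) of (s, r) \<Rightarrow> prod (f s) (g r)))
          \<le> norm (norm (f s) * ((LINT r|?M. norm (g r)) * K))"
        by (intro AE_I2) (simp only: case_prod_conv)
    qed
    show "AE s in ?M. integrable ?M (\<lambda>r. case (s, r) of (s, r) \<Rightarrow> prod (f s) (g r))"
      using pgi by simp
  qed
  have idm[measurable]: "(\<lambda>x. x) \<in> borel_measurable ?M"
    by (intro continuous_imp_measurable_on_sets_lebesgue continuous_intros) auto
  have "{z \<in> space (?M \<Otimes>\<^sub>M ?M). fst z \<le> snd z} \<in> sets (?M \<Otimes>\<^sub>M ?M)"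
    by (rule borel_measurable_le) (auto intro: measurable_compose[OF measurable_fst idm] measurable_compose[OF measurable_snd idm])
  then have int': "integrable (?M \<Otimes>\<^sub>M ?M) (\<lambda>z. indicator {z \<in> space (?M \<Otimes>\<^sub>M ?M). fst z \<le> snd z} z *\<^sub>R (case z of (s, r) \<Rightarrow> prod (f s) (g r)))"
    by (intro integrable_mult_indicator int)
  have int'': "integrable (?M \<Otimes>\<^sub>M ?M) (\<lambda>(s, r). indicator {..r} s *\<^sub>R prod (f s) (g r))"
    by (rule Bochner_Integration.integrable_cong[THEN iffD1, OF refl _ int'])
       (auto simp: indicator_def space_pair_measure)
  have swap: "(LINT r|?M. LINT s|?M. indicator {..r} s *\<^sub>R prod (f s) (g r)) =
    (LINT s|?M. LINT r|?M. indicator {..r} s *\<^sub>R prod (f s) (g r))"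
    using P.Fubini_integral[OF int''] by simp
  have fI: "integrable ?M (\<lambda>s. indicator {..r} s *\<^sub>R f s)" for r
    by (intro integrable_lebesgue_on_indicator fi) auto
  have gI: "integrable ?M (\<lambda>s. indicator {..r} s *\<^sub>R g s)" for r
    by (intro integrable_lebesgue_on_indicator gi) auto
  have 1: "(LINT s|?M. indicator {..r} s *\<^sub>R prod (f s) (g r)) = prod (integral {0..r} f) (g r)"
    if "r \<in> {0..T}" for r
  proof -
    have "(LINT s|?M. indicator {..r} s *\<^sub>R prod (f s) (g r)) = (LINT s|?M. prod (indicator {..r} s *\<^sub>R f s) (g r))"
      by (simp add: scaleR_left)
    also have "\<dots> = prod (LINT s|?M. indicator {..r} s *\<^sub>R f s) (g r)"
      by (rule integral_bounded_linear[OF bounded_linear_left fI])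
    finally show ?thesis using integral_upto_eq_LINT[OF f that] by simp
  qed
  have 2: "(LINT r|?M. indicator {..r} s *\<^sub>R prod (f s) (g r)) =
      prod (f s) (integral {0..T} g) - prod (f s) (integral {0..s} g)"
    if "s \<in> {0..T}" for s
  proof -
    \<comment> \<open>Up to the null set of the diagonal, \<open>s \<le> r\<close> is the complement of \<open>r \<le> s\<close>.\<close>
    have ae: "AE r in ?M. r \<noteq> s"
      using that by (intro AE_I[of _ _ "{s}"]) (auto simp: emeasure_restrict_space sets_restrict_space)
    have "(LINT r|?M. indicator {..r} s *\<^sub>R prod (f s) (g r)) =
       (LINT r|?M. prod (f s) (g r) - prod (f s) (indicator {..s} r *\<^sub>R g r))"
    proof (rule integral_cong_AE)
      have "integrable ?M (\<lambda>r. indicator {s..} r *\<^sub>R prod (f s) (g r))"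
        by (rule integrable_lebesgue_on_indicator[OF pgi]) auto
      then have "integrable ?M (\<lambda>r. indicator {..r} s *\<^sub>R prod (f s) (g r))"
        by (simp add: indicator_def)
      then show "(\<lambda>r. indicator {..r} s *\<^sub>R prod (f s) (g r)) \<in> borel_measurable ?M"
        by (rule borel_measurable_integrable)
      show "(\<lambda>r. prod (f s) (g r) - prod (f s) (indicator {..s} r *\<^sub>R g r)) \<in> borel_measurable ?M"
        by (intro borel_measurable_integrable Bochner_Integration.integrable_diff pgi
            integrable_bounded_linear[OF bl1 gI])
      show "AE r in ?M. indicator {..r} s *\<^sub>R prod (f s) (g r) =
          prod (f s) (g r) - prod (f s) (indicator {..s} r *\<^sub>R g r)"
        using ae by eventually_elim (auto simp: indicator_def zero_right)
    qed
    also have "\<dots> = (LINT r|?M. prod (f s) (g r)) - (LINT r|?M. prod (f s) (indicator {..s} r *\<^sub>R g r))"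
      by (intro Bochner_Integration.integral_diff integrable_bounded_linear[OF bl1] gi gI)
    also have "\<dots> = prod (f s) (LINT r|?M. g r) - prod (f s) (LINT r|?M. indicator {..s} r *\<^sub>R g r)"
      by (simp only: integral_bounded_linear[OF bl1 gi] integral_bounded_linear[OF bl1 gI])
    also have "(LINT r|?M. g r) = integral {0..T} g" by (rule lebesgue_integral_eq_integral[OF gi]) auto
    finally show ?thesis using integral_upto_eq_LINT[OF g that] by simp
  qed
  have AI: "integrable ?M (\<lambda>t. prod (integral {0..t} f) (g t))" and BI: "integrable ?M (\<lambda>t. prod (f t) (integral {0..t} g))"
    using A B by (simp_all add: set_integrable_def integrable_restrict_space)
  have "integral {0..T} (\<lambda>t. prod (integral {0..t} f) (g t)) = (LINT r|?M. prod (integral {0..r} f) (g r))"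
    by (rule lebesgue_integral_eq_integral[OF AI, symmetric]) auto
  also have "\<dots> = (LINT r|?M. LINT s|?M. indicator {..r} s *\<^sub>R prod (f s) (g r))"
    by (intro Bochner_Integration.integral_cong) (auto simp: 1)
  also have "\<dots> = (LINT s|?M. prod (f s) (integral {0..T} g) - prod (f s) (integral {0..s} g))"
    unfolding swap by (intro Bochner_Integration.integral_cong) (auto simp: 2)
  also have "\<dots> = (LINT s|?M. prod (f s) (integral {0..T} g)) - (LINT s|?M. prod (f s) (integral {0..s} g))"
    by (intro Bochner_Integration.integral_diff BI integrable_bounded_linear[OF bounded_linear_left fi])
  also have "(LINT s|?M. prod (f s) (integral {0..T} g)) = prod (LINT s|?M. f s) (integral {0..T} g)"
    by (rule integral_bounded_linear[OF bounded_linear_left fi])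
  also have "(LINT s|?M. f s) = integral {0..T} f" by (rule lebesgue_integral_eq_integral[OF fi]) auto
  also have "(LINT s|?M. prod (f s) (integral {0..s} g)) = integral {0..T} (\<lambda>t. prod (f t) (integral {0..t} g))"
    by (rule lebesgue_integral_eq_integral[OF BI]) auto
  finally show "prod (integral {0..T} f) (integral {0..T} g) =
      integral {0..T} (\<lambda>t. prod (integral {0..t} f) (g t)) +
      integral {0..T} (\<lambda>t. prod (f t) (integral {0..t} g))" by simp
qed

text \<open>
  The energy identity: \<open>|u|\<^sup>2\<close> is the primitive of \<open>2 u \<bullet> g\<close> when \<open>u\<close> is a primitive of \<open>g\<close>.
\<close>

lemma norm_square_primitive:
  fixes g u :: "real \<Rightarrow> 'a::euclidean_space"
  assumes g: "g absolutely_integrable_on {0..t}" and t: "0 \<le> t"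
    and u: "\<And>s. s \<in> {0..t} \<Longrightarrow> u s = u0 + integral {0..s} g"
  shows "(\<lambda>s. u s \<bullet> g s) absolutely_integrable_on {0..t}"
    and "(norm (u t))\<^sup>2 = (norm u0)\<^sup>2 + 2 * integral {0..t} (\<lambda>s. u s \<bullet> g s)"
proof -
  note ibp = integral_by_parts_absolutely_integrable[OF bounded_bilinear_inner g g]
  have i0: "(\<lambda>s. u0 \<bullet> g s) absolutely_integrable_on {0..t}"
    using absolutely_integrable_linear[OF g bounded_linear_inner_right[of u0]] by (simp add: o_def)
  have i1: "(\<lambda>s. u0 \<bullet> g s + integral {0..s} g \<bullet> g s) absolutely_integrable_on {0..t}"
    by (rule set_integral_add(1)[OF i0 ibp(1)])
  have eq: "u s \<bullet> g s = u0 \<bullet> g s + integral {0..s} g \<bullet> g s" if "s \<in> {0..t}" for s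
    by (simp add: u[OF that] inner_add_left)
  show "(\<lambda>s. u s \<bullet> g s) absolutely_integrable_on {0..t}"
    by (rule absolutely_integrable_spike[OF i1, of "{}"]) (use eq in auto)
  have "integral {0..t} (\<lambda>s. u s \<bullet> g s) = integral {0..t} (\<lambda>s. u0 \<bullet> g s + integral {0..s} g \<bullet> g s)"
    by (rule integral_cong) (rule eq)
  also have "\<dots> = integral {0..t} (\<lambda>s. u0 \<bullet> g s) + integral {0..t} (\<lambda>s. integral {0..s} g \<bullet> g s)"
    by (intro Henstock_Kurzweil_Integration.integral_add set_lebesgue_integral_eq_integral(1) i0 ibp(1))
  also have "integral {0..t} (\<lambda>s. u0 \<bullet> g s) = u0 \<bullet> integral {0..t} g"
    using integral_linear[OF set_lebesgue_integral_eq_integral(1)[OF g] bounded_linear_inner_right[of u0]]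
    by (simp add: o_def)
  finally have I: "integral {0..t} (\<lambda>s. u s \<bullet> g s) =
      u0 \<bullet> integral {0..t} g + integral {0..t} (\<lambda>s. integral {0..s} g \<bullet> g s)" .
  have "integral {0..t} g \<bullet> integral {0..t} g = 2 * integral {0..t} (\<lambda>s. integral {0..s} g \<bullet> g s)"
    using ibp(3) by (simp add: inner_commute[of "g _"])
  then show "(norm (u t))\<^sup>2 = (norm u0)\<^sup>2 + 2 * integral {0..t} (\<lambda>s. u s \<bullet> g s)"
    using t unfolding I
    by (simp add: u power2_norm_eq_inner inner_add_left inner_add_right inner_commute[of "integral {0..t} g" u0])
qed

section \<open>Weak derivatives and primitives\<close>

lemma LINT_Ioo_eq_integral_Icc:
  fixes f :: "real \<Rightarrow> 'a::euclidean_space"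
  assumes "f absolutely_integrable_on {0..T}"
  shows "(LINT t|lebesgue_on {0<..<T}. f t) = integral {0..T} f"
proof -
  have "integrable (lebesgue_on {0<..<T}) f"
    using assms[unfolded absolutely_integrable_on_Icc_iff_Ioo]
    by (simp add: set_integrable_def integrable_restrict_space)
  then show ?thesis
    by (simp add: lebesgue_integral_eq_integral integral_open_interval_real)
qed

lemma L2_space_imp_absolutely_integrable:
  fixes f :: "real \<Rightarrow> 'a::euclidean_space"
  assumes "f \<in> L2_space T"
  shows "f absolutely_integrable_on {0..T}"
proof -
  let ?M = "lebesgue_on {0<..<T}"
  have fm: "f \<in> borel_measurable ?M" and fi: "integrable ?M (\<lambda>t. (norm (f t))\<^sup>2)"
    using assms by (auto simp: L2_space_def)
  interpret M: finite_measure ?M by (rule finite_measure_lebesgue_on) auto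
  have "integrable ?M f"
  proof (rule Bochner_Integration.integrable_bound[OF _ fm])
    show "integrable ?M (\<lambda>t. 1 + (norm (f t))\<^sup>2)" using fi by simp
    have "norm (f t) \<le> 1 + (norm (f t))\<^sup>2" for t
      using zero_le_power2[of "norm (f t) - 1"] by (simp add: power2_diff) (smt (verit) norm_ge_zero)
    then show "AE t in ?M. norm (f t) \<le> norm (1 + (norm (f t))\<^sup>2)"
      by (intro AE_I2) (smt (verit) real_norm_def)
  qed
  then have "f absolutely_integrable_on {0<..<T}"
    by (simp add: set_integrable_def integrable_restrict_space)
  then show ?thesis by (simp add: absolutely_integrable_on_Icc_iff_Ioo)
qed

lemma weak_derivative_primitive:
  fixes x x' :: "real \<Rightarrow> 'a::euclidean_space"
  assumes x': "x' absolutely_integrable_on {0..T}" and T: "0 < T"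
    and x: "\<And>t. t \<in> {0..T} \<Longrightarrow> x t = x 0 + integral {0..t} x'"
  shows "weak_derivative T x x'"
  unfolding weak_derivative_def
proof (intro allI impI)
  fix \<theta> \<theta>' assume "test_function T \<theta> \<theta>'"
  then obtain c d where d: "\<And>t. (\<theta> has_real_derivative \<theta>' t) (at t)" and c: "continuous_on UNIV \<theta>'"
    and cd: "0 < c" "d < T" "\<And>t. t \<notin> {c..d} \<Longrightarrow> \<theta> t = 0"
    by (auto simp: test_function_def)
  have \<theta>0: "\<theta> 0 = 0" "\<theta> T = 0" using cd by auto
  have \<theta>ai: "\<theta>' absolutely_integrable_on {0..T}"
    by (rule absolutely_integrable_continuous_real) (rule continuous_on_subset[OF c], simp)
  have \<theta>: "integral {0..t} \<theta>' = \<theta> t" if "t \<in> {0..T}" for t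
    using fundamental_theorem_of_calculus[of 0 t \<theta> \<theta>'] that d \<theta>0
    by (auto simp: has_real_derivative_iff_has_vector_derivative
        intro!: integral_unique dest: has_vector_derivative_at_within)
  note ibp = integral_by_parts_absolutely_integrable[OF bounded_bilinear_scaleR \<theta>ai x']
  have xd: "x t - x 0 = integral {0..t} x'" if "t \<in> {0..T}" for t
    using x[OF that] by simp
  have i1: "(\<lambda>t. \<theta> t *\<^sub>R x' t) absolutely_integrable_on {0..T}"
    by (rule absolutely_integrable_spike[OF ibp(1), of "{}"]) (auto simp: \<theta>)
  have i2: "(\<lambda>t. \<theta>' t *\<^sub>R (x t - x 0)) absolutely_integrable_on {0..T}"
    by (rule absolutely_integrable_spike[OF ibp(2), of "{}"]) (auto simp: xd)
  have i3: "(\<lambda>t. \<theta>' t *\<^sub>R x 0) absolutely_integrable_on {0..T}"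
    using \<theta>ai by (rule absolutely_integrable_scaleR_right)
  have split: "\<theta>' t *\<^sub>R x t = \<theta>' t *\<^sub>R (x t - x 0) + \<theta>' t *\<^sub>R x 0" for t
    by (simp add: scaleR_diff_right)
  have i4: "(\<lambda>t. \<theta>' t *\<^sub>R x t) absolutely_integrable_on {0..T}"
    unfolding split by (rule set_integral_add(1)[OF i2 i3])
  have e1: "integral {0..T} (\<lambda>t. integral {0..t} \<theta>' *\<^sub>R x' t) = integral {0..T} (\<lambda>t. \<theta> t *\<^sub>R x' t)"
    by (rule integral_cong) (simp add: \<theta>)
  have e2: "integral {0..T} (\<lambda>t. \<theta>' t *\<^sub>R integral {0..t} x') = integral {0..T} (\<lambda>t. \<theta>' t *\<^sub>R (x t - x 0))"
    by (rule integral_cong) (simp add: xd)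
  have "0 = integral {0..T} (\<lambda>t. \<theta> t *\<^sub>R x' t) + integral {0..T} (\<lambda>t. \<theta>' t *\<^sub>R (x t - x 0))"
    using ibp(3) T unfolding e1 e2 by (simp add: \<theta> \<theta>0)
  also have "integral {0..T} (\<lambda>t. \<theta>' t *\<^sub>R (x t - x 0)) =
      integral {0..T} (\<lambda>t. \<theta>' t *\<^sub>R x t) - integral {0..T} (\<lambda>t. \<theta>' t *\<^sub>R x 0)"
    unfolding scaleR_diff_right
    by (intro Henstock_Kurzweil_Integration.integral_diff set_lebesgue_integral_eq_integral(1) i4 i3)
  also have "integral {0..T} (\<lambda>t. \<theta>' t *\<^sub>R x 0) = integral {0..T} \<theta>' *\<^sub>R x 0"
    using \<theta>ai by (intro integral_unique has_integral_scaleR_left) 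
      (simp add: set_lebesgue_integral_eq_integral(1) integrable_integral)
  also have "integral {0..T} \<theta>' = 0" using T by (simp add: \<theta> \<theta>0)
  finally have "integral {0..T} (\<lambda>t. \<theta>' t *\<^sub>R x t) + integral {0..T} (\<lambda>t. \<theta> t *\<^sub>R x' t) = 0"
    by (simp add: add.commute)
  then show "(LINT t|lebesgue_on {0<..<T}. \<theta>' t *\<^sub>R x t) = - (LINT t|lebesgue_on {0<..<T}. \<theta> t *\<^sub>R x' t)"
    unfolding LINT_Ioo_eq_integral_Icc[OF i1] LINT_Ioo_eq_integral_Icc[OF i4]
    by (rule eq_neg_iff_add_eq_0[THEN iffD2])
qed

text \<open>
  Test functions are built from the second difference of \<open>t\<^sub>+\<^sup>2 / 2\<close>: its derivative is a tent over
  \<open>[- \<epsilon>, \<epsilon>]\<close>, and it is constant on either side of that interval.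
\<close>

lemma has_real_derivative_half_square_pos_part:
  "((\<lambda>t. (max 0 t)\<^sup>2 / 2) has_real_derivative max 0 t) (at (t::real))"
proof -
  consider "t < 0" | "t = 0" | "t > 0" by linarith
  then show ?thesis
  proof cases
    case 1
    have ev: "eventually (\<lambda>t. (max 0 t)\<^sup>2 / 2 = (0::real)) (nhds t)"
      using eventually_nhds_in_open[of "{..<0}" t] 1 by (auto elim!: eventually_mono)
    from DERIV_cong_ev[OF refl ev refl, of "max 0 t"] 1 show ?thesis by simp
  next
    case 2
    have "((\<lambda>h. (max 0 h)\<^sup>2 / 2 / h) \<longlongrightarrow> 0) (at (0::real))"
    proof (rule Lim_null_comparison)
      have "norm ((max 0 h)\<^sup>2 / 2 / h) \<le> \<bar>h\<bar>" for h :: real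
        by (cases "h > 0") (auto simp: power2_eq_square max_def)
      then show "\<forall>\<^sub>F h in at (0::real). norm ((max 0 h)\<^sup>2 / 2 / h) \<le> \<bar>h\<bar>" by simp
      show "((\<lambda>h. \<bar>h\<bar>) \<longlongrightarrow> 0) (at (0::real))" by (rule tendsto_rabs_zero) (rule tendsto_ident_at)
    qed
    then show ?thesis using 2 by (simp add: DERIV_def)
  next
    case 3
    have ev: "eventually (\<lambda>t. (max 0 t)\<^sup>2 / 2 = (t\<^sup>2 / 2::real)) (nhds t)"
      using eventually_nhds_in_open[of "{0<..}" t] 3 by (auto elim!: eventually_mono)
    have "((\<lambda>t. t\<^sup>2 / 2) has_real_derivative max 0 t) (at t)"
      using 3 by (auto intro!: derivative_eq_intros)
    with DERIV_cong_ev[OF refl ev refl, of "max 0 t"] show ?thesis by blast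
  qed
qed

lemma bump_exists:
  assumes "0 < (\<epsilon>::real)"
  obtains B b :: "real \<Rightarrow> real"
  where "\<And>t. (B has_real_derivative b t) (at t)" "continuous_on UNIV b"
    "\<And>t. 0 \<le> b t" "\<And>t. \<epsilon> \<le> \<bar>t\<bar> \<Longrightarrow> b t = 0" "0 < b 0"
    "\<And>t. t \<le> - \<epsilon> \<Longrightarrow> B t = 0" "\<And>t. \<epsilon> \<le> t \<Longrightarrow> B t = \<epsilon>\<^sup>2"
proof -
  define q where "q = (\<lambda>t::real. (max 0 t)\<^sup>2 / 2)"
  define B where "B = (\<lambda>t. q (t + \<epsilon>) - 2 * q t + q (t - \<epsilon>))"
  define b where "b = (\<lambda>t::real. max 0 (t + \<epsilon>) - 2 * max 0 t + max 0 (t - \<epsilon>))"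
  have q: "((\<lambda>t. q (t + c)) has_real_derivative max 0 (t + c)) (at t)" for t c
    using has_real_derivative_half_square_pos_part[of "t + c"] unfolding q_def
    by (simp add: DERIV_shift)
  show ?thesis
  proof (rule that[of B b])
    show "(B has_real_derivative b t) (at t)" for t
      unfolding B_def b_def
      using q[of \<epsilon> t] q[of 0 t] q[of "- \<epsilon>" t]
      by (auto intro!: derivative_eq_intros)
    show "continuous_on UNIV b" unfolding b_def by (intro continuous_intros)
    show "B t = \<epsilon>\<^sup>2" if "\<epsilon> \<le> t" for t
      using assms that by (simp add: B_def q_def power2_eq_square field_simps)
  qed (use assms in \<open>auto simp: b_def B_def q_def\<close>)
qed

lemma continuous_on_pos_near:
  fixes f :: "real \<Rightarrow> real"
  assumes "continuous_on S f" "s \<in> S" "0 < f s"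
  obtains \<delta> where "0 < \<delta>" "\<And>r. r \<in> S \<Longrightarrow> \<bar>r - s\<bar> < \<delta> \<Longrightarrow> 0 < f r"
proof -
  obtain \<delta> where \<delta>: "0 < \<delta>" "\<And>r. r \<in> S \<Longrightarrow> dist r s < \<delta> \<Longrightarrow> dist (f r) (f s) < f s"
    using assms unfolding continuous_on_iff by metis
  have "0 < f r" if "r \<in> S" "\<bar>r - s\<bar> < \<delta>" for r
    using \<delta>(2)[of r] that by (simp add: dist_real_def abs_less_iff)
  with \<delta>(1) that show ?thesis by blast
qed

text \<open>
  The test function used here has a derivative that is a tent around \<open>s\<close> minus a tent around \<open>t\<close>. If
  \<open>z s \<noteq> z t\<close>, then for narrow tents the component of \<open>z\<close> along \<open>z s - z t\<close>, shifted by its mean value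
  \<open>c\<close> at the two points, is positive under the first tent and negative under the second, so that its
  integral against this derivative cannot vanish.
\<close>

lemma du_Bois_Reymond:
  fixes z :: "real \<Rightarrow> 'a::euclidean_space"
  assumes z: "continuous_on {0..T} z" and T: "0 < T"
    and 0: "\<And>\<theta> \<theta>'. test_function T \<theta> \<theta>' \<Longrightarrow> integral {0..T} (\<lambda>t. \<theta>' t *\<^sub>R z t) = 0"
    and t: "t \<in> {0..T}"
  shows "z t = z 0"
proof -
  have open_const: "z s = z t" if s: "s \<in> {0<..<T}" and t: "t \<in> {0<..<T}" for s t
  proof (rule ccontr)
    assume "z s \<noteq> z t"
    define v where "v = z s - z t"
    define c where "c = (z s \<bullet> v + z t \<bullet> v) / 2"
    define \<zeta> where "\<zeta> = (\<lambda>r. z r \<bullet> v - c)"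
    have "z s \<bullet> v - z t \<bullet> v > 0" using \<open>z s \<noteq> z t\<close> by (simp add: v_def flip: inner_diff_left)
    then have \<zeta>st: "\<zeta> s > 0" "\<zeta> t < 0" by (simp_all add: \<zeta>_def c_def field_simps)
    have \<zeta>c: "continuous_on {0..T} \<zeta>" unfolding \<zeta>_def by (intro continuous_intros z)
    obtain \<delta>1 where \<delta>1: "\<delta>1 > 0" "\<And>r. r \<in> {0..T} \<Longrightarrow> \<bar>r - s\<bar> < \<delta>1 \<Longrightarrow> \<zeta> r > 0"
      using continuous_on_pos_near[OF \<zeta>c _ \<zeta>st(1)] s by auto
    obtain \<delta>2 where \<delta>2: "\<delta>2 > 0" "\<And>r. r \<in> {0..T} \<Longrightarrow> \<bar>r - t\<bar> < \<delta>2 \<Longrightarrow> \<zeta> r < 0"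
      using continuous_on_pos_near[OF continuous_on_minus[OF \<zeta>c], of t] t \<zeta>st(2) by auto
    define \<epsilon> where "\<epsilon> = min (min \<delta>1 \<delta>2) (min (min s (T - s)) (min t (T - t))) / 2"
    have \<epsilon>: "0 < \<epsilon>" "\<epsilon> < \<delta>1" "\<epsilon> < \<delta>2" "\<epsilon> < s" "\<epsilon> < T - s" "\<epsilon> < t" "\<epsilon> < T - t"
      using \<delta>1 \<delta>2 s t by (auto simp: \<epsilon>_def)
    obtain B b where B: "\<And>t. (B has_real_derivative b t) (at t)" and bc: "continuous_on UNIV b"
      and b: "\<And>t. 0 \<le> b t" "\<And>t. \<epsilon> \<le> \<bar>t\<bar> \<Longrightarrow> b t = 0" "0 < b 0"
      and B0: "\<And>t. t \<le> - \<epsilon> \<Longrightarrow> B t = 0" "\<And>t. \<epsilon> \<le> t \<Longrightarrow> B t = \<epsilon>\<^sup>2"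
      using bump_exists[OF \<epsilon>(1)] by metis
    define \<theta> where "\<theta> = (\<lambda>r. B (r - s) - B (r - t))"
    define \<theta>' where "\<theta>' = (\<lambda>r. b (r - s) - b (r - t))"
    have d: "(\<theta> has_real_derivative \<theta>' r) (at r)" for r
      using B[of "r - s"] B[of "r - t"] DERIV_shift[of B _ r "-s"] DERIV_shift[of B _ r "-t"]
      unfolding \<theta>_def \<theta>'_def by (auto intro!: derivative_intros)
    have \<theta>'c: "continuous_on UNIV \<theta>'" unfolding \<theta>'_def
      by (intro continuous_intros continuous_on_compose2[OF bc]) auto
    have supp: "\<theta> r = 0" if "r \<notin> {min s t - \<epsilon>..max s t + \<epsilon>}" for r
      using that B0 \<epsilon>(1) by (auto simp: \<theta>_def not_le)
    have "test_function T \<theta> \<theta>'"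
      unfolding test_function_def
      using d \<theta>'c supp \<epsilon> by (intro conjI allI exI[of _ "min s t - \<epsilon>"] exI[of _ "max s t + \<epsilon>"]) auto
    from 0[OF this] have I0: "integral {0..T} (\<lambda>r. \<theta>' r *\<^sub>R z r) = 0" .
    have \<theta>'c': "continuous_on {0..T} \<theta>'" by (rule continuous_on_subset[OF \<theta>'c]) simp
    have "(\<lambda>r. \<theta>' r *\<^sub>R z r) integrable_on {0..T}"
      by (intro integrable_continuous_real continuous_intros \<theta>'c' z)
    with I0 have "((\<lambda>r. \<theta>' r *\<^sub>R z r) has_integral 0) {0..T}" by (metis integrable_integral)
    from has_integral_linear[OF this bounded_linear_inner_left[of v]]
    have i1: "((\<lambda>r. \<theta>' r * (z r \<bullet> v)) has_integral 0) {0..T}" by (simp add: o_def)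
    have "(\<theta>' has_integral \<theta> T - \<theta> 0) {0..T}"
      using d T by (intro fundamental_theorem_of_calculus)
        (auto simp: has_real_derivative_iff_has_vector_derivative dest: has_vector_derivative_at_within)
    moreover have "\<theta> T = 0" "\<theta> 0 = 0" 
      using \<epsilon> by (auto intro!: supp simp: max_def min_def split: if_splits)
    ultimately have "((\<lambda>r. \<theta>' r * c) has_integral 0) {0..T}"
      using has_integral_mult_left[of \<theta>' 0 "{0..T}" c] by simp
    from has_integral_diff[OF i1 this] have i2: "((\<lambda>r. \<theta>' r * \<zeta> r) has_integral 0) {0..T}"
      by (simp add: \<zeta>_def algebra_simps)
    have st: "\<epsilon> \<le> \<bar>s - t\<bar>"
    proof (rule ccontr)
      assume "\<not> \<epsilon> \<le> \<bar>s - t\<bar>"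
      then have "\<zeta> s < 0" using \<delta>2(2)[of s] s \<epsilon> by auto
      then show False using \<zeta>st by simp
    qed
    have "\<theta>' s * \<zeta> s = 0"
    proof (rule has_integral_0_cbox_imp_0[of 0 T "\<lambda>r. \<theta>' r * \<zeta> r" s])
      show "continuous_on (cbox 0 T) (\<lambda>r. \<theta>' r * \<zeta> r)"
        by (simp, intro continuous_intros \<theta>'c' \<zeta>c)
      show "0 \<le> \<theta>' r * \<zeta> r" if "r \<in> box 0 T" for r
      proof -
        have r: "r \<in> {0..T}" using that by auto
        have "0 \<le> b (r - s) * \<zeta> r"
          using b(1)[of "r - s"] b(2)[of "r - s"] \<delta>1(2)[OF r] \<epsilon>(2)
          by (cases "\<epsilon> \<le> \<bar>r - s\<bar>") auto
        moreover have "0 \<ge> b (r - t) * \<zeta> r"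
          using b(1)[of "r - t"] b(2)[of "r - t"] \<delta>2(2)[OF r] \<epsilon>(3)
          by (cases "\<epsilon> \<le> \<bar>r - t\<bar>") (auto simp: mult_le_0_iff)
        ultimately show ?thesis by (simp add: \<theta>'_def left_diff_distrib)
      qed
    qed (use i2 T s in auto)
    moreover have "\<theta>' s > 0" using b(2)[OF st] b(3) by (simp add: \<theta>'_def)
    ultimately show False using \<zeta>st by simp
  qed
  define m where "m = T / 2"
  have m: "m \<in> {0<..<T}" using T by (simp add: m_def)
  have "z r = z m" if "r \<in> {0..T}" for r
  proof (rule continuous_constant_on_closure[of "{0<..<T}"])
    show "continuous_on (closure {0<..<T}) z" using T z by simp
    show "z q = z m" if "q \<in> {0<..<T}" for q by (rule open_const[OF that m])
    show "r \<in> closure {0<..<T}" using that T by simp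
  qed
  from this[OF t] this[of 0] T show ?thesis by simp
qed

lemma weak_derivative_imp_primitive:
  fixes x x' :: "real \<Rightarrow> 'a::euclidean_space"
  assumes x: "continuous_on {0..T} x" and x': "x' absolutely_integrable_on {0..T}" and T: "0 < T"
    and w: "weak_derivative T x x'" and t: "t \<in> {0..T}"
  shows "x t = x 0 + integral {0..t} x'"
proof -
  define y where "y = (\<lambda>t. integral {0..t} x')"
  have y: "continuous_on {0..T} y"
    unfolding y_def by (intro indefinite_integral_continuous_1 set_lebesgue_integral_eq_integral(1) x')
  have wy: "weak_derivative T y x'"
    by (rule weak_derivative_primitive[OF x' T]) (simp add: y_def)
  have "x t - y t = x 0 - y 0"
  proof (rule du_Bois_Reymond[OF _ T _ t])
    show "continuous_on {0..T} (\<lambda>t. x t - y t)" by (intro continuous_intros x y)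
    fix \<theta> \<theta>' assume \<theta>: "test_function T \<theta> \<theta>'"
    have c: "continuous_on {0..T} \<theta>'" 
      using \<theta> by (auto simp: test_function_def intro: continuous_on_subset)
    have ix: "(\<lambda>t. \<theta>' t *\<^sub>R x t) absolutely_integrable_on {0..T}"
      and iy: "(\<lambda>t. \<theta>' t *\<^sub>R y t) absolutely_integrable_on {0..T}"
      by (auto intro!: absolutely_integrable_continuous_real continuous_intros c x y)
    have "integral {0..T} (\<lambda>t. \<theta>' t *\<^sub>R x t) = integral {0..T} (\<lambda>t. \<theta>' t *\<^sub>R y t)"
      using w wy \<theta> unfolding weak_derivative_def LINT_Ioo_eq_integral_Icc[OF ix, symmetric]
        LINT_Ioo_eq_integral_Icc[OF iy, symmetric] by simp
    then show "integral {0..T} (\<lambda>t. \<theta>' t *\<^sub>R (x t - y t)) = 0"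
      using ix iy by (simp add: scaleR_diff_right Henstock_Kurzweil_Integration.integral_diff
          set_lebesgue_integral_eq_integral(1))
  qed
  then show ?thesis by (simp add: y_def algebra_simps)
qed

section \<open>Lipschitz functions as primitives\<close>

text \<open>
  The functions \<open>F 1\<close> and \<open>F (-1)\<close> below are nondecreasing and add up to the identity. Hence their
  Stieltjes measures add up to Lebesgue measure, each of them is absolutely continuous, and the
  Radon-Nikodym theorem gives a density for \<open>F 1\<close>, which is an affine function of \<open>g\<close> and \<open>t\<close>.
\<close>

lemma Lipschitz_has_density:
  fixes g :: "real \<Rightarrow> real"
  assumes L: "0 < L" and lip: "\<And>s t. \<bar>g s - g t\<bar> \<le> L * \<bar>s - t\<bar>"
  obtains f where "\<And>s t. s \<le> t \<Longrightarrow> (f has_integral g t - g s) {s..t}"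
proof -
  define F where "F = (\<lambda>\<sigma> t. (t + \<sigma> * g t / L) / 2)"
  have contg: "continuous_on UNIV g"
    by (rule lipschitz_on_continuous_on[where L = L])
       (use L lip in \<open>auto simp: lipschitz_on_def dist_real_def\<close>)
  have monoF: "F \<sigma> s \<le> F \<sigma> t" if "s \<le> t" "\<bar>\<sigma>\<bar> = 1" for s t \<sigma>
  proof -
    have "\<bar>\<sigma> * (g s - g t)\<bar> \<le> L * (t - s)"
      using lip[of s t] that by (simp add: abs_mult)
    then have "\<sigma> * g s - \<sigma> * g t \<le> L * (t - s)"
      by (simp add: right_diff_distrib abs_le_iff)
    then have "(\<sigma> * g s - \<sigma> * g t) / L \<le> t - s"
      using L by (simp add: divide_le_eq mult.commute)
    then have "s + \<sigma> * g s / L \<le> t + \<sigma> * g t / L"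
      by (simp add: diff_divide_distrib)
    then show ?thesis unfolding F_def by (rule divide_right_mono) auto
  qed
  have contF: "continuous_on UNIV (F \<sigma>)" for \<sigma>
    unfolding F_def using L by (intro continuous_intros contg) auto
  then have rcF: "continuous (at_right t) (F \<sigma>)" for \<sigma> t
    using continuous_at_imp_continuous_at_within continuous_on_eq_continuous_at by blast
  have Ioc: "emeasure (interval_measure (F \<sigma>)) {s<..t} = ennreal (F \<sigma> t - F \<sigma> s)"
    if "s \<le> t" "\<bar>\<sigma>\<bar> = 1" for s t \<sigma>
    using that by (intro emeasure_interval_measure_Ioc monoF rcF)
  define \<mu> where "\<mu> = (\<lambda>A. emeasure (interval_measure (F 1)) A + emeasure (interval_measure (F (-1))) A)"
  define M where "M = measure_of UNIV (sets borel) \<mu>"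
  have sM: "sets M = sets borel"
    by (simp add: M_def sets.sigma_sets_eq[of borel, simplified])
  have eM: "emeasure M A = \<mu> A" if "A \<in> sets borel" for A
  proof (rule emeasure_measure_of[OF M_def])
    show "positive (sets M) \<mu>" by (simp add: positive_def \<mu>_def)
    show "countably_additive (sets M) \<mu>"
      by (auto simp: countably_additive_def \<mu>_def sM suminf_add[symmetric] suminf_emeasure)
  qed (use that sM in auto)
  have "lborel = M"
  proof (rule measure_eqI_generator_eq[where \<Omega> = UNIV
        and E = "range (\<lambda>(a, b). {a<..b::real})" and A = "\<lambda>i. {- real i <.. real i}"])
    show "Int_stable (range (\<lambda>(a, b). {a<..b::real}))"
      proof (rule Int_stableI_image)
      fix i j :: "real \<times> real"
      have "{fst i<..snd i} \<inter> {fst j<..snd j} = {max (fst i) (fst j)<..min (snd i) (snd j)}"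
        by auto
      then show "\<exists>k\<in>UNIV. (case i of (a, b) \<Rightarrow> {a<..b}) \<inter> (case j of (a, b) \<Rightarrow> {a<..b}) = (case k of (a, b) \<Rightarrow> {a<..b})"
        by (intro bexI[of _ "(max (fst i) (fst j), min (snd i) (snd j))"]) (auto simp: case_prod_unfold)
    qed
  next
    fix X assume "X \<in> range (\<lambda>(a, b). {a<..b::real})"
    then obtain a b where X: "X = {a<..b}" by auto
    show "emeasure lborel X = emeasure M X"
    proof (cases "a \<le> b")
      case True
      have "emeasure M X = ennreal (F 1 b - F 1 a) + ennreal (F (-1) b - F (-1) a)"
        using True by (simp add: X eM \<mu>_def Ioc)
      also have "\<dots> = ennreal (F 1 b - F 1 a + (F (-1) b - F (-1) a))"
        using monoF[OF True, of 1] monoF[OF True, of "-1"] by (subst ennreal_plus) auto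
      also have "F 1 b - F 1 a + (F (-1) b - F (-1) a) = b - a"
        using L by (simp add: F_def field_simps)
      finally show ?thesis using True by (simp add: X)
    qed (simp add: X)
  next
    show "(\<Union>i. {- real i<..real i}) = UNIV"
    proof (rule sym, intro UNIV_eq_I)
      fix x :: real
      obtain i :: nat where "\<bar>x\<bar> < real i" using reals_Archimedean2 by blast
      then show "x \<in> (\<Union>i. {- real i<..real i})" by (auto intro!: exI[of _ i])
    qed
  qed (auto simp: sM borel_sigma_sets_Ioc)
  then have ac: "absolutely_continuous lborel (interval_measure (F 1))"
    using eM by (auto simp: absolutely_continuous_def null_sets_def \<mu>_def)
  then obtain \<rho> where \<rho>: "\<rho> \<in> borel_measurable lborel"
      and dens: "density lborel \<rho> = interval_measure (F 1)"
    using sigma_finite_measure.Radon_Nikodym[OF sigma_finite_lborel ac] by auto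
  define f where "f = (\<lambda>t. enn2real (\<rho> t))"
  have fm: "f \<in> borel_measurable borel" using \<rho> by (simp add: f_def)
  have "(f has_integral F 1 t - F 1 s) {s..t}" if st: "s \<le> t" for s t
  proof -
    have nn: "(\<integral>\<^sup>+x. \<rho> x * indicator {s<..t} x \<partial>lborel) = ennreal (F 1 t - F 1 s)"
      using \<rho> Ioc[OF st, of 1] by (simp add: emeasure_density flip: dens)
    have "AE x in lborel. \<rho> x * indicator {s<..t} x \<noteq> \<infinity>"
      using \<rho> nn by (intro nn_integral_PInf_AE) auto
    then have AE: "AE x in lborel. ennreal (f x * indicator {s..t} x) = \<rho> x * indicator {s<..t} x"
      using AE_lborel_singleton[of s]
    proof eventually_elim
      case (elim x)
      then show ?case
        by (auto simp: f_def indicator_def less_top[symmetric])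
    qed
    have "(\<integral>\<^sup>+x. ennreal (f x * indicator {s..t} x) \<partial>lborel) = ennreal (F 1 t - F 1 s)"
      using nn_integral_cong_AE[OF AE] nn by simp
    then have "((\<lambda>x. f x * indicator {s..t} x) has_integral (F 1 t - F 1 s)) UNIV"
      using fm monoF[OF st, of 1]
      by (intro nn_integral_has_integral) (auto simp: f_def)
    moreover have "(\<lambda>x. f x * indicator {s..t} x) = (\<lambda>x. if x \<in> {s..t} then f x else 0)"
      by (auto simp: indicator_def)
    ultimately show ?thesis by (simp only: has_integral_restrict_UNIV)
  qed
  then have "((\<lambda>x. 2 * L * f x - L) has_integral 2 * L * (F 1 t - F 1 s) - L * (t - s)) {s..t}"
    if "s \<le> t" for s t
    using has_integral_const_real[of L s t] that
    by (intro has_integral_diff has_integral_mult_right) (auto simp: mult.commute)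
  moreover have "2 * L * (F 1 t - F 1 s) - L * (t - s) = g t - g s" for s t
    using L by (simp add: F_def field_simps)
  ultimately show ?thesis by (intro that) auto
qed

text \<open>
  A Lipschitz function is the primitive of a function that is, off a null set, its right derivative.
  This combines the density above, applied to the components, with Lebesgue's differentiation
  theorem.
\<close>

lemma Lipschitz_right_density:
  fixes H :: "real \<Rightarrow> 'a::euclidean_space"
  assumes T: "0 < T" and lip: "\<And>s t. s \<in> {0..T} \<Longrightarrow> t \<in> {0..T} \<Longrightarrow> norm (H t - H s) \<le> L * \<bar>t - s\<bar>"
  obtains \<eta> N where "negligible N"
    "\<And>t. t \<in> {0..T} \<Longrightarrow> (\<eta> has_integral H t - H 0) {0..t}"
    "\<And>s e. s \<in> {0..<T} - N \<Longrightarrow> 0 < e \<Longrightarrow>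
       \<exists>\<delta>>0. \<forall>h. 0 < h \<and> h < \<delta> \<longrightarrow> norm ((H (s + h) - H s) /\<^sub>R h - \<eta> s) < e"
proof -
  \<comment> \<open>\<open>H \<circ> c\<close> extends \<open>H\<close> from \<open>[0,T]\<close> to a Lipschitz function on the line.\<close>
  define c where "c = (\<lambda>t. max 0 (min T t))"
  have c: "c t \<in> {0..T}" "\<bar>c t - c s\<bar> \<le> \<bar>t - s\<bar>" for s t
    using T by (auto simp: c_def)
  have cid: "c t = t" if "t \<in> {0..T}" for t using that by (auto simp: c_def)
  have L0: "0 \<le> L" 
    using order_trans[OF norm_ge_zero lip[of 0 T]] T by (simp add: zero_le_mult_iff)
  have "\<exists>f. \<forall>s t. s \<le> t \<longrightarrow> (f has_integral H (c t) \<bullet> i - H (c s) \<bullet> i) {s..t}" if "i \<in> Basis" for i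
  proof (rule Lipschitz_has_density[of "L + 1" "\<lambda>t. H (c t) \<bullet> i"])
    fix s t
    have "\<bar>H (c s) \<bullet> i - H (c t) \<bullet> i\<bar> \<le> norm (H (c s) - H (c t))"
      using Basis_le_norm[OF that, of "H (c s) - H (c t)"] by (simp add: inner_diff_left)
    also have "\<dots> \<le> L * \<bar>c s - c t\<bar>" by (rule lip[OF c(1) c(1)])
    also have "\<dots> \<le> (L + 1) * \<bar>s - t\<bar>" by (rule mult_mono) (use L0 c in auto)
    finally show "\<bar>H (c s) \<bullet> i - H (c t) \<bullet> i\<bar> \<le> (L + 1) * \<bar>s - t\<bar>" .
  qed (use L0 in auto)
  then obtain f where f: "\<And>i s t. i \<in> Basis \<Longrightarrow> s \<le> t \<Longrightarrow> (f i has_integral H (c t) \<bullet> i - H (c s) \<bullet> i) {s..t}"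
    by metis
  define \<eta> where "\<eta> = (\<lambda>t. \<Sum>i\<in>Basis. f i t *\<^sub>R i)"
  have \<eta>: "(\<eta> has_integral H (c t) - H (c s)) {s..t}" if "s \<le> t" for s t
  proof -
    have "(\<eta> has_integral (\<Sum>i\<in>Basis. (H (c t) \<bullet> i - H (c s) \<bullet> i) *\<^sub>R i)) {s..t}"
      unfolding \<eta>_def using f[OF _ that] by (intro has_integral_sum has_integral_scaleR_left) auto
    also have "(\<Sum>i\<in>Basis. (H (c t) \<bullet> i - H (c s) \<bullet> i) *\<^sub>R i) = H (c t) - H (c s)"
      using euclidean_representation[of "H (c t) - H (c s)"] by (simp only: inner_diff_left)
    finally show ?thesis .
  qed
  have "\<eta> integrable_on cbox a b" for a b
    using \<eta>[of a b] by (cases "a \<le> b") (auto simp: integrable_on_def)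
  then obtain N where N: "negligible N"
    and der: "\<And>x e. \<lbrakk>x \<notin> N; 0 < e\<rbrakk> \<Longrightarrow> \<exists>d>0. \<forall>h. 0 < h \<and> h < d \<longrightarrow>
      norm (integral (cbox x (x + h *\<^sub>R One)) \<eta> /\<^sub>R h ^ DIM(real) - \<eta> x) < e"
    using integrable_ccontinuous_explicit[of \<eta>] by blast
  show ?thesis
  proof (rule that[OF N])
    show "(\<eta> has_integral H t - H 0) {0..t}" if "t \<in> {0..T}" for t
      using \<eta>[of 0 t] that T by (simp add: cid)
    fix s e :: real assume s: "s \<in> {0..<T} - N" and e: "0 < e"
    obtain d where d: "d > 0" "\<And>h. 0 < h \<Longrightarrow> h < d \<Longrightarrow>
        norm (integral (cbox s (s + h *\<^sub>R One)) \<eta> /\<^sub>R h ^ DIM(real) - \<eta> s) < e"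
      using der[of s e] s e by auto
    have "norm ((H (s + h) - H s) /\<^sub>R h - \<eta> s) < e" if h: "0 < h" "h < min d (T - s)" for h
    proof -
      have "integral {s..s + h} \<eta> = H (s + h) - H s"
        using \<eta>[of s "s + h"] h s by (intro integral_unique) (auto simp: cid)
      then show ?thesis using d(2)[of h] h by simp
    qed
    then show "\<exists>\<delta>>0. \<forall>h. 0 < h \<and> h < \<delta> \<longrightarrow> norm ((H (s + h) - H s) /\<^sub>R h - \<eta> s) < e"
      using d s by (intro exI[of _ "min d (T - s)"]) auto
  qed
qed

section \<open>Euler polygons for a bounded field\<close>

text \<open>
  The time spent before \<open>t\<close> in the cell \<open>[j d, (j + 1) d]\<close>.
\<close>

definition cell_time :: "real \<Rightarrow> nat \<Rightarrow> real \<Rightarrow> real" where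
  "cell_time d j t = min d (max 0 (t - real j * d))"

lemma sum_cell_time:
  assumes "0 \<le> d" "0 \<le> t"
  shows "(\<Sum>j<k. cell_time d j t) = min t (real k * d)"
proof (induction k)
  case (Suc k)
  have "real (Suc k) * d = real k * d + d" by (simp add: algebra_simps)
  then show ?case using Suc assms by (simp add: cell_time_def min_def max_def split: if_splits)
qed (use assms in auto)

lemma cell_time_mono: "s \<le> t \<Longrightarrow> cell_time d j s \<le> cell_time d j t"
  by (auto simp: cell_time_def)

lemma cell_time_less_imp:
  assumes "cell_time d j s < cell_time d j t"
  shows "s - d < real j * d" "real j * d < t"
  using assms by (auto simp: cell_time_def min_def max_def split: if_splits)

text \<open>
  The nodes of the explicit Euler scheme with step \<open>d\<close> for \<open>H' = F (b - A H)\<close>, \<open>H 0 = 0\<close>.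
\<close>

fun Euler_node :: "(real \<Rightarrow> 'a::real_normed_vector) \<Rightarrow> ('a \<Rightarrow> 'a) \<Rightarrow> ('a \<Rightarrow> 'a) \<Rightarrow> real \<Rightarrow> nat \<Rightarrow> 'a" where
  "Euler_node b A F d 0 = 0"
| "Euler_node b A F d (Suc j) = Euler_node b A F d j + d *\<^sub>R F (b (real j * d) - A (Euler_node b A F d j))"

text \<open>
  The increment over \<open>[s,t]\<close> of the Euler polygon with \<open>k\<close> steps is an average of values of \<open>F\<close> at nodes in
  \<open>(s - T / k, t)\<close>, times \<open>t - s\<close>. The third property expresses this in terms of half-spaces containing
  those values.
\<close>

lemma Euler_polygon:
  fixes b :: "real \<Rightarrow> 'a::euclidean_space" and A F :: "'a \<Rightarrow> 'a"
  assumes T: "0 < T" and k: "0 < k" and L: "\<And>y. norm (F y) \<le> L"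
  obtains H where "H 0 = 0"
    "\<And>s t. s \<in> {0..T} \<Longrightarrow> t \<in> {0..T} \<Longrightarrow> norm (H t - H s) \<le> L * \<bar>t - s\<bar>"
    "\<And>s t v c. \<lbrakk>0 \<le> s; s \<le> t; t \<le> T;
        \<And>r. r \<in> {0..T} \<Longrightarrow> s - T / real k < r \<Longrightarrow> r < t \<Longrightarrow> c \<le> F (b r - A (H r)) \<bullet> v\<rbrakk>
      \<Longrightarrow> c * (t - s) \<le> (H t - H s) \<bullet> v"
proof -
  define d where "d = T / real k"
  have d: "0 < d" "real k * d = T" using T k by (auto simp: d_def)
  define G where "G = Euler_node b A F d"
  define W where "W = (\<lambda>j. F (b (real j * d) - A (G j)))"
  define H where "H = (\<lambda>t. \<Sum>j<k. cell_time d j t *\<^sub>R W j)"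
  have sum1: "(\<Sum>j<k. cell_time d j t) = t" if "t \<in> {0..T}" for t
    using sum_cell_time[of d t k] that d by auto
  \<comment> \<open>The polygon \<open>H\<close> takes the values \<open>G j\<close> at the nodes.\<close>
  have node: "H (real j * d) = G j" if "j \<le> k" for j
  proof -
    have "cell_time d i (real j * d) = (if i < j then d else 0)" for i
    proof (cases "i < j")
      case True
      then have "1 * d \<le> (real j - real i) * d" using d by (intro mult_right_mono) auto
      then show ?thesis using True d by (simp add: cell_time_def left_diff_distrib)
    next
      case False
      then have "real j * d \<le> real i * d" using d by (intro mult_right_mono) auto
      then show ?thesis using False d by (simp add: cell_time_def)
    qed
    then have "H (real j * d) = (\<Sum>i\<in>{..<k}. if i \<in> {..<j} then d *\<^sub>R W i else 0)"
      by (auto simp: H_def intro!: sum.cong)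
    also have "\<dots> = (\<Sum>i\<in>{..<k} \<inter> {..<j}. d *\<^sub>R W i)"
      by (rule sum.inter_restrict[symmetric]) simp
    also have "{..<k} \<inter> {..<j} = {..<j}" using that by auto
    also have "(\<Sum>i<j. d *\<^sub>R W i) = G j"
      by (induction j) (auto simp: G_def W_def)
    finally show ?thesis .
  qed
  have diff: "H t - H s = (\<Sum>j<k. (cell_time d j t - cell_time d j s) *\<^sub>R W j)" for s t
    by (simp add: H_def sum_subtractf scaleR_diff_left)
  have lower: "c * (t - s) \<le> (H t - H s) \<bullet> v"
    if st: "0 \<le> s" "s \<le> t" "t \<le> T"
      and c: "\<And>r. r \<in> {0..T} \<Longrightarrow> s - d < r \<Longrightarrow> r < t \<Longrightarrow> c \<le> F (b r - A (H r)) \<bullet> v" for s t v c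
  proof -
    have "c * (t - s) = (\<Sum>j<k. (cell_time d j t - cell_time d j s) * c)"
      using st unfolding sum_distrib_right[symmetric] sum_subtractf by (simp add: sum1 mult.commute)
    also have "\<dots> \<le> (\<Sum>j<k. (cell_time d j t - cell_time d j s) * (W j \<bullet> v))"
    proof (rule sum_mono)
      fix j assume j: "j \<in> {..<k}"
      show "(cell_time d j t - cell_time d j s) * c \<le> (cell_time d j t - cell_time d j s) * (W j \<bullet> v)"
      proof (cases "cell_time d j s < cell_time d j t")
        case True
        have "real j * d \<in> {0..T}"
          using cell_time_less_imp(2)[OF True] d st by auto
        then have "c \<le> W j \<bullet> v"
          using c[of "real j * d"] cell_time_less_imp[OF True] j node[of j] by (simp add: W_def)
        then show ?thesis using True by (intro mult_left_mono) auto
      next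
        case False
        then have "cell_time d j t = cell_time d j s" using cell_time_mono[OF st(2), of d j] by simp
        then show ?thesis by simp
      qed
    qed
    also have "\<dots> = (H t - H s) \<bullet> v" by (simp add: diff inner_sum_left)
    finally show ?thesis .
  qed
  have lip: "norm (H t - H s) \<le> L * (t - s)" if "0 \<le> s" "s \<le> t" "t \<le> T" for s t
  proof -
    have "norm (H t - H s) \<le> (\<Sum>j<k. (cell_time d j t - cell_time d j s) * L)"
      unfolding diff
      by (intro sum_norm_le) (use cell_time_mono[OF that(2)] L in \<open>auto simp: W_def intro!: mult_mono\<close>)
    also have "\<dots> = L * (t - s)"
      using that unfolding sum_distrib_right[symmetric] sum_subtractf by (simp add: sum1 mult.commute)
    finally show ?thesis .
  qed
  show ?thesis
  proof (rule that[of H])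
    show "H 0 = 0" using node[of 0] by (simp add: G_def)
    show "norm (H t - H s) \<le> L * \<bar>t - s\<bar>" if "s \<in> {0..T}" "t \<in> {0..T}" for s t
      using lip[of s t] lip[of t s] that by (cases "s \<le> t") (auto simp: norm_minus_commute)
  qed (use lower d_def in auto)
qed

text \<open>
  A limit of the polygons as the step tends to 0, obtained with the theorem of Arzela and Ascoli. No
  continuity of \<open>F\<close> is assumed; the last property is what survives of the equation: a half-space that
  contains all values of \<open>F\<close> near \<open>b s - A (H s)\<close> contains the difference quotients of \<open>H\<close> to the
  right of \<open>s\<close>. In other words, \<open>H\<close> solves the differential inclusion for the closed convex hull of
  the limit values of \<open>F\<close>.
\<close>

lemma Euler_limit:
  fixes b :: "real \<Rightarrow> 'a::euclidean_space" and A F :: "'a \<Rightarrow> 'a"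
  assumes T: "0 < T" and b: "continuous_on {0..T} b" and A: "bounded_linear A"
    and L: "\<And>y. norm (F y) \<le> L"
  obtains H where "H 0 = 0"
    "\<And>s t. s \<in> {0..T} \<Longrightarrow> t \<in> {0..T} \<Longrightarrow> norm (H t - H s) \<le> L * \<bar>t - s\<bar>"
    "\<And>s v c \<rho>. \<lbrakk>s \<in> {0..<T}; 0 < \<rho>; \<And>y. dist y (b s - A (H s)) < \<rho> \<Longrightarrow> c \<le> F y \<bullet> v\<rbrakk>
      \<Longrightarrow> \<exists>\<delta>>0. \<forall>t. s < t \<longrightarrow> t < s + \<delta> \<longrightarrow> c * (t - s) \<le> (H t - H s) \<bullet> v"
proof -
  interpret A: bounded_linear A by (rule A)
  have L0: "0 \<le> L" using norm_ge_zero[of "F 0"] L[of 0] by linarith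
  have "\<exists>H. H 0 = 0 \<and>
    (\<forall>s t. s \<in> {0..T} \<longrightarrow> t \<in> {0..T} \<longrightarrow> norm (H t - H s) \<le> L * \<bar>t - s\<bar>) \<and>
    (\<forall>s t v c. 0 \<le> s \<longrightarrow> s \<le> t \<longrightarrow> t \<le> T \<longrightarrow>
       (\<forall>r. r \<in> {0..T} \<longrightarrow> s - T / real (Suc n) < r \<longrightarrow> r < t \<longrightarrow> c \<le> F (b r - A (H r)) \<bullet> v)
      \<longrightarrow> c * (t - s) \<le> (H t - H s) \<bullet> v)" for n
    by (rule Euler_polygon[where b = b and A = A and F = F and L = L, OF T zero_less_Suc[of n]])
      (rule L, blast)
  then obtain P where P0: "\<And>n. P n 0 = 0"
    and Plip: "\<And>n s t. s \<in> {0..T} \<Longrightarrow> t \<in> {0..T} \<Longrightarrow> norm (P n t - P n s) \<le> L * \<bar>t - s\<bar>"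
    and Plow: "\<And>n s t v c. \<lbrakk>0 \<le> s; s \<le> t; t \<le> T;
       \<And>r. r \<in> {0..T} \<Longrightarrow> s - T / real (Suc n) < r \<Longrightarrow> r < t \<Longrightarrow> c \<le> F (b r - A (P n r)) \<bullet> v\<rbrakk>
      \<Longrightarrow> c * (t - s) \<le> (P n t - P n s) \<bullet> v"
    by metis
  obtain H \<phi> where Hc: "continuous_on {0..T} H" and \<phi>: "strict_mono (\<phi> :: nat \<Rightarrow> nat)"
    and conv: "\<And>e. 0 < e \<Longrightarrow> \<exists>N. \<forall>n x. n \<ge> N \<and> x \<in> {0..T} \<longrightarrow> norm (P (\<phi> n) x - H x) < e"
  proof (rule Arzela_Ascoli[of "{0..T}" P "L * T"])
    show "norm (P n t) \<le> L * T" if "t \<in> {0..T}" for n t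
      using Plip[of 0 t n] that P0[of n] L0 mult_left_mono[of t T L] by auto
    show "\<exists>d>0. \<forall>n y. y \<in> {0..T} \<and> norm (t - y) < d \<longrightarrow> norm (P n t - P n y) < e"
      if "t \<in> {0..T}" "0 < e" for t e
    \<comment> \<open>The denominator is \<open>L + 1\<close> because \<open>L\<close> may be 0.\<close>
    proof (intro exI[of _ "e / (L + 1)"] conjI allI impI)
      show "0 < e / (L + 1)" using that L0 by simp
      fix n y assume y: "y \<in> {0..T} \<and> norm (t - y) < e / (L + 1)"
      then have "norm (P n t - P n y) \<le> L * \<bar>t - y\<bar>" using Plip that by blast
      also have "\<dots> \<le> (L + 1) * \<bar>t - y\<bar>" by (simp add: algebra_simps)
      also have "\<dots> < e" using y L0 by (simp add: less_divide_eq mult.commute)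
      finally show "norm (P n t - P n y) < e" .
    qed
  qed auto
  have lim: "(\<lambda>n. P (\<phi> n) t) \<longlonglongrightarrow> H t" if "t \<in> {0..T}" for t
    using conv that unfolding lim_sequentially dist_norm by blast
  define x where "x = (\<lambda>t. b t - A (H t))"
  have xc: "continuous_on {0..T} x"
    unfolding x_def by (intro continuous_intros b A.continuous_on Hc)
  obtain K where K: "K > 0" "\<And>y. norm (A y) \<le> norm y * K" using A.pos_bounded by blast
  show ?thesis
  proof (rule that[of H])
    show "H 0 = 0" using lim[of 0] P0 T by (simp add: LIMSEQ_const_iff)
    show "norm (H t - H s) \<le> L * \<bar>t - s\<bar>" if "s \<in> {0..T}" "t \<in> {0..T}" for s t
      by (rule LIMSEQ_le_const2[OF tendsto_norm[OF tendsto_diff[OF lim[OF that(2)] lim[OF that(1)]]]])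
         (use Plip that in blast)
    fix s v c and \<rho> :: real
    assume s: "s \<in> {0..<T}" and \<rho>: "0 < \<rho>" and c: "\<And>y. dist y (b s - A (H s)) < \<rho> \<Longrightarrow> c \<le> F y \<bullet> v"
    obtain \<delta> where \<delta>: "0 < \<delta>" "\<And>r. r \<in> {0..T} \<Longrightarrow> dist r s < \<delta> \<Longrightarrow> dist (x r) (x s) < \<rho> / 2"
      using xc s \<rho> unfolding continuous_on_iff by (metis atLeastAtMost_iff atLeastLessThan_iff half_gt_zero order.strict_implies_order)
    obtain N1 where N1: "\<And>n r. n \<ge> N1 \<Longrightarrow> r \<in> {0..T} \<Longrightarrow> norm (P (\<phi> n) r - H r) < \<rho> / 2 / K"
      using conv[of "\<rho> / 2 / K"] \<rho> K by auto
    obtain N2 :: nat where N2: "T / \<delta> < real N2" using reals_Archimedean2 by blast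
    have near: "dist (b r - A (P (\<phi> n) r)) (x s) < \<rho>"
      if "n \<ge> N1" "r \<in> {0..T}" "dist r s < \<delta>" for n r
    proof -
      have "dist (b r - A (P (\<phi> n) r)) (x r) = norm (A (P (\<phi> n) r - H r))"
        by (simp add: x_def dist_norm A.diff norm_minus_commute)
      also have "\<dots> \<le> norm (P (\<phi> n) r - H r) * K" by (rule K)
      also have "\<dots> < \<rho> / 2" using N1[OF that(1,2)] K(1) by (simp add: less_divide_eq)
      finally show ?thesis using \<delta>(2)[OF that(2,3)] dist_triangle_half_l[of _ "x r" \<rho>]
        by (metis dist_commute dist_triangle_half_r)
    qed
    have "c * (t - s) \<le> (H t - H s) \<bullet> v" if t: "s < t" "t < s + min \<delta> (T - s)" for t
    proof (rule LIMSEQ_le_const[OF tendsto_inner[OF tendsto_diff[OF lim lim] tendsto_const]])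
      show "\<exists>N. \<forall>n\<ge>N. c * (t - s) \<le> (P (\<phi> n) t - P (\<phi> n) s) \<bullet> v"
      proof (intro exI[of _ "max N1 N2"] allI impI)
        fix n assume n: "max N1 N2 \<le> n"
        have "T / \<delta> < real (Suc (\<phi> n))"
          using N2 n seq_suble[OF \<phi>, of n] by linarith
        then have "T / real (Suc (\<phi> n)) < \<delta>" using \<delta>(1) by (simp add: field_simps)
        then show "c * (t - s) \<le> (P (\<phi> n) t - P (\<phi> n) s) \<bullet> v"
          using s t n by (intro Plow c near[unfolded x_def]) (auto simp: dist_real_def)
      qed
    qed (use s t in auto)
    then show "\<exists>\<delta>>0. \<forall>t. s < t \<longrightarrow> t < s + \<delta> \<longrightarrow> c * (t - s) \<le> (H t - H s) \<bullet> v"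
      using \<delta>(1) s by (intro exI[of _ "min \<delta> (T - s)"]) auto
  qed
qed

section \<open>Flows along subgradients\<close>

text \<open>
  The radial retraction onto the closed ball of radius \<open>R\<close>. Unlike an arbitrary truncation, it moves a
  point along its ray, which the a priori estimate below relies on.
\<close>

definition retract_ball :: "real \<Rightarrow> 'a::real_normed_vector \<Rightarrow> 'a" where
  "retract_ball R x = (R / max R (norm x)) *\<^sub>R x"

lemma norm_retract_ball: "0 < R \<Longrightarrow> norm (retract_ball R x) \<le> R"
  by (auto simp: retract_ball_def max_def field_simps mult_left_mono)

lemma retract_ball_id: "0 < R \<Longrightarrow> norm x \<le> R \<Longrightarrow> retract_ball R x = x"
  by (simp add: retract_ball_def max_def)

lemma isCont_retract_ball: "0 < R \<Longrightarrow> isCont (retract_ball R) x"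
  unfolding retract_ball_def by (intro continuous_intros) (auto simp: max_def)

text \<open>
  A nonnegative function vanishing at 0, with a subgradient \<open>\<sigma> x\<close> at every point \<open>x\<close> that is bounded on
  balls. This makes \<open>\<phi>\<close> convex and locally Lipschitz.
\<close>

locale subgradient_selection =
  fixes \<phi> :: "'a::euclidean_space \<Rightarrow> real" and \<sigma> :: "'a \<Rightarrow> 'a"
  assumes sub: "\<phi> x + \<sigma> x \<bullet> (z - x) \<le> \<phi> z"
    and bounded_on_balls: "\<exists>L. \<forall>x. norm x \<le> R \<longrightarrow> norm (\<sigma> x) \<le> L"
    and nonneg: "0 \<le> \<phi> x" and zero: "\<phi> 0 = 0"
begin

lemma Lipschitz_on_ball:
  assumes L: "\<And>x. norm x \<le> R \<Longrightarrow> norm (\<sigma> x) \<le> L" and x: "norm x \<le> R"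
  shows "\<phi> x - \<phi> y \<le> L * dist x y"
proof -
  have "\<phi> x - \<phi> y \<le> \<sigma> x \<bullet> (x - y)" using sub[of x y] by (simp add: inner_diff_right)
  also have "\<dots> \<le> norm (\<sigma> x) * norm (x - y)" by (rule norm_cauchy_schwarz)
  also have "\<dots> \<le> L * norm (x - y)" using L[OF x] by (intro mult_right_mono) auto
  finally show ?thesis by (simp add: dist_norm)
qed

text \<open>
  The field \<open>\<sigma> \<circ> retract_ball R\<close> is bounded, so that the limit of its Euler polygons is available. The
  inequalities that define a subgradient are half-space conditions that are stable under perturbation of
  the base point, and therefore pass to the right derivative of the limit.
\<close>

lemma truncated_inclusion:
  fixes b :: "real \<Rightarrow> 'a" and A :: "'a \<Rightarrow> 'a"
  assumes T: "0 < T" and b: "continuous_on {0..T} b" and A: "bounded_linear A" and R: "0 < R"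
  obtains H \<eta> L where "continuous_on {0..T} H"
    "\<And>t. t \<in> {0..T} \<Longrightarrow> (\<eta> has_integral H t) {0..t}"
    "\<And>t. t \<in> {0..T} \<Longrightarrow> norm (\<eta> t) \<le> L"
    "\<And>t z. t \<in> {0..T} \<Longrightarrow> \<phi> (retract_ball R (b t - A (H t))) + \<eta> t \<bullet> (z - retract_ball R (b t - A (H t))) \<le> \<phi> z"
proof -
  let ?P = "retract_ball R"
  obtain L where L: "\<And>x. norm x \<le> R \<Longrightarrow> norm (\<sigma> x) \<le> L" using bounded_on_balls[of R] by blast
  have L0: "0 \<le> L" using order_trans[OF norm_ge_zero L[of 0]] R by simp
  define F where "F = (\<lambda>y. \<sigma> (?P y))"
  have F: "norm (F y) \<le> L" for y unfolding F_def by (rule L[OF norm_retract_ball[OF R]])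
  obtain H where H0: "H 0 = 0"
    and Hlip: "\<And>s t. s \<in> {0..T} \<Longrightarrow> t \<in> {0..T} \<Longrightarrow> norm (H t - H s) \<le> L * \<bar>t - s\<bar>"
    and Hlow: "\<And>s v c \<rho>. \<lbrakk>s \<in> {0..<T}; 0 < \<rho>; \<And>y. dist y (b s - A (H s)) < \<rho> \<Longrightarrow> c \<le> F y \<bullet> v\<rbrakk>
      \<Longrightarrow> \<exists>\<delta>>0. \<forall>t. s < t \<longrightarrow> t < s + \<delta> \<longrightarrow> c * (t - s) \<le> (H t - H s) \<bullet> v"
    by (rule Euler_limit[where b = b and A = A and F = F and L = L, OF T b A F]) blast
  obtain \<eta> N where N: "negligible N"
    and \<eta>: "\<And>t. t \<in> {0..T} \<Longrightarrow> (\<eta> has_integral H t - H 0) {0..t}"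
    and der: "\<And>s e. s \<in> {0..<T} - N \<Longrightarrow> 0 < e \<Longrightarrow>
       \<exists>\<delta>>0. \<forall>h. 0 < h \<and> h < \<delta> \<longrightarrow> norm ((H (s + h) - H s) /\<^sub>R h - \<eta> s) < e"
    by (rule Lipschitz_right_density[OF T Hlip]) (assumption | blast)+
  have Hc: "continuous_on {0..T} H"
    by (rule lipschitz_on_continuous_on[of L])
       (use Hlip L0 in \<open>auto simp: lipschitz_on_def dist_norm\<close>)
  define x where "x = (\<lambda>t. b t - A (H t))"
  have lower: "c \<le> \<eta> s \<bullet> v"
    if s: "s \<in> {0..<T} - N" and \<rho>: "0 < \<rho>" and c: "\<And>y. dist y (x s) < \<rho> \<Longrightarrow> c \<le> F y \<bullet> v" for s v c \<rho>
  proof (rule field_le_epsilon)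
    fix e :: real assume e: "0 < e"
    obtain \<delta>1 where \<delta>1: "\<delta>1 > 0" "\<And>t. s < t \<Longrightarrow> t < s + \<delta>1 \<Longrightarrow> c * (t - s) \<le> (H t - H s) \<bullet> v"
      using Hlow[of s \<rho> c v] s \<rho> c by (auto simp: x_def)
    have "0 < e / (norm v + 1)" using e norm_ge_zero[of v] by (intro divide_pos_pos) linarith+
    then obtain \<delta>2 where \<delta>2: "\<delta>2 > 0" "\<And>h. 0 < h \<Longrightarrow> h < \<delta>2 \<Longrightarrow>
        norm ((H (s + h) - H s) /\<^sub>R h - \<eta> s) < e / (norm v + 1)"
      using der[OF s] by blast
    define h where "h = min \<delta>1 \<delta>2 / 2"
    have h: "0 < h" "h < \<delta>1" "h < \<delta>2" using \<delta>1 \<delta>2 by (auto simp: h_def)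
    have "c \<le> ((H (s + h) - H s) /\<^sub>R h) \<bullet> v"
      using \<delta>1(2)[of "s + h"] h by (simp add: inverse_eq_divide pos_le_divide_eq)
    moreover have "((H (s + h) - H s) /\<^sub>R h) \<bullet> v = \<eta> s \<bullet> v + ((H (s + h) - H s) /\<^sub>R h - \<eta> s) \<bullet> v"
      by (simp add: inner_diff_left)
    moreover have "((H (s + h) - H s) /\<^sub>R h - \<eta> s) \<bullet> v \<le> e"
    proof -
      have "((H (s + h) - H s) /\<^sub>R h - \<eta> s) \<bullet> v \<le> norm ((H (s + h) - H s) /\<^sub>R h - \<eta> s) * norm v"
        by (rule norm_cauchy_schwarz)
      also have "\<dots> \<le> e / (norm v + 1) * (norm v + 1)"
        using \<delta>2(2)[OF h(1,3)] \<open>0 < e / (norm v + 1)\<close> by (intro mult_mono) auto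
      also have "\<dots> = e" using norm_ge_zero[of v] by (intro nonzero_eq_divide_eq[THEN iffD1, OF _ refl]) linarith
      finally show ?thesis .
    qed
    ultimately show "c \<le> \<eta> s \<bullet> v + e" by linarith
  qed
  have subgrad: "\<phi> (?P (x s)) + \<eta> s \<bullet> (z - ?P (x s)) \<le> \<phi> z" if s: "s \<in> {0..<T} - N" for s z
  proof -
    let ?q = "?P (x s)"
    have "\<phi> ?q - \<phi> z \<le> \<eta> s \<bullet> (?q - z)"
    proof (rule field_le_epsilon)
      fix e :: real assume e: "0 < e"
      then have "0 < e / (2 * L + 1)" using L0 by simp
      then obtain \<rho> where \<rho>: "\<rho> > 0" "\<And>y. dist y (x s) < \<rho> \<Longrightarrow> dist (?P y) ?q < e / (2 * L + 1)"
        using isCont_retract_ball[OF R, of "x s"] unfolding continuous_at_eps_delta dist_norm by metis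
      have "\<phi> ?q - \<phi> z - e \<le> \<eta> s \<bullet> (?q - z)"
      proof (rule lower[OF s \<rho>(1)])
        fix y assume y: "dist y (x s) < \<rho>"
        have "\<phi> ?q - \<phi> (?P y) \<le> L * dist ?q (?P y)"
          by (rule Lipschitz_on_ball[OF L norm_retract_ball[OF R]])
        moreover have "\<phi> (?P y) - \<phi> z \<le> F y \<bullet> (?P y - z)"
          using sub[of "?P y" z] by (simp add: F_def inner_diff_right)
        moreover have "F y \<bullet> (?P y - ?q) \<le> L * dist ?q (?P y)"
        proof -
          have "F y \<bullet> (?P y - ?q) \<le> norm (F y) * norm (?P y - ?q)" by (rule norm_cauchy_schwarz)
          also have "\<dots> \<le> L * norm (?P y - ?q)" by (intro mult_right_mono F) auto
          finally show ?thesis by (simp add: dist_norm norm_minus_commute)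
        qed
        moreover have "2 * (L * dist ?q (?P y)) \<le> e"
        proof -
          have "2 * (L * dist ?q (?P y)) \<le> (2 * L + 1) * dist ?q (?P y)" by (simp add: algebra_simps)
          also have "\<dots> \<le> (2 * L + 1) * (e / (2 * L + 1))"
            using \<rho>(2)[OF y] L0 by (intro mult_left_mono) (auto simp: dist_commute)
          finally show ?thesis using L0 by simp
        qed
        moreover have "F y \<bullet> (?q - z) = F y \<bullet> (?P y - z) - F y \<bullet> (?P y - ?q)"
          by (simp add: inner_diff_right)
        ultimately show "\<phi> ?q - \<phi> z - e \<le> F y \<bullet> (?q - z)" by linarith
      qed
      then show "\<phi> ?q - \<phi> z \<le> \<eta> s \<bullet> (?q - z) + e" by simp
    qed
    then show ?thesis by (simp add: inner_diff_right)
  qed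
  have \<eta>L: "norm (\<eta> s) \<le> L" if s: "s \<in> {0..<T} - N" for s
  proof (cases "\<eta> s = 0")
    case False
    have "- (L * norm (\<eta> s)) \<le> \<eta> s \<bullet> (- \<eta> s)"
    proof (rule lower[OF s zero_less_one])
      fix y
      have "F y \<bullet> \<eta> s \<le> norm (F y) * norm (\<eta> s)" by (rule norm_cauchy_schwarz)
      also have "\<dots> \<le> L * norm (\<eta> s)" by (intro mult_right_mono F) auto
      finally show "- (L * norm (\<eta> s)) \<le> F y \<bullet> (- \<eta> s)" by simp
    qed
    then have "norm (\<eta> s) * norm (\<eta> s) \<le> L * norm (\<eta> s)"
      by (simp add: dot_square_norm power2_eq_square)
    then show ?thesis using False by simp
  qed (simp add: L0)
  \<comment> \<open>On the exceptional null set the density is replaced by a value of \<open>F\<close>, so that no null set remains.\<close>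
  define \<eta>' where "\<eta>' = (\<lambda>t. if t \<in> {0..<T} - N then \<eta> t else F (x t))"
  show ?thesis
  proof (rule that[OF Hc])
    fix t assume t: "t \<in> {0..T}"
    show "(\<eta>' has_integral H t) {0..t}"
    proof (rule has_integral_spike[of "insert T N"])
      show "negligible (insert T N)" using N by simp
      show "\<eta>' r = \<eta> r" if "r \<in> {0..t} - insert T N" for r using that t by (auto simp: \<eta>'_def)
      show "(\<eta> has_integral H t) {0..t}" using \<eta>[OF t] by (simp add: H0)
    qed
    show "norm (\<eta>' t) \<le> L" using \<eta>L F by (auto simp: \<eta>'_def)
    fix z
    show "\<phi> (?P (b t - A (H t))) + \<eta>' t \<bullet> (z - ?P (b t - A (H t))) \<le> \<phi> z"
      using subgrad[of t z] sub[of "?P (x t)" z] by (auto simp: \<eta>'_def F_def x_def)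
  qed
qed

text \<open>
  Here \<open>\<pi>\<close> is an orthogonal projection, \<open>a\<close> runs in its kernel, and the equation for \<open>u = x - a\<close> in its
  range is \<open>u' = \<pi> (h - \<eta>)\<close> with \<open>\<eta>\<close> a subgradient at \<open>x\<close>. The solution of the truncated problem satisfies
  \<open>u \<bullet> u' \<le> |u| |h| + C\<close> with \<open>C\<close> independent of the truncation radius: along the ray the truncation
  does no harm, as \<open>\<eta> \<bullet> retract_ball R x \<ge> 0\<close>. For \<open>M = max |u|\<close> this yields
  \<open>M\<^sup>2 \<le> |u0|\<^sup>2 + 2 B M + 2 C T\<close> with \<open>B\<close> the integral of \<open>|h|\<close>, so that a radius chosen in
  advance exceeds \<open>|x|\<close> and the truncation is inactive.
\<close>

lemma gradient_flow_exists:
  fixes a h :: "real \<Rightarrow> 'a" and \<pi> :: "'a \<Rightarrow> 'a"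
  assumes T: "0 < T" and a: "continuous_on {0..T} a" and h: "h absolutely_integrable_on {0..T}"
    and \<pi>: "bounded_linear \<pi>" "\<And>x. \<pi> (\<pi> x) = \<pi> x" "\<And>x y. \<pi> x \<bullet> y = x \<bullet> \<pi> y"
    and \<pi>a: "\<And>t. t \<in> {0..T} \<Longrightarrow> \<pi> (a t) = 0" and \<pi>u0: "\<pi> u0 = u0"
  obtains x \<eta> L where "continuous_on {0..T} x"
    "\<eta> absolutely_integrable_on {0..T}" "\<And>t. t \<in> {0..T} \<Longrightarrow> norm (\<eta> t) \<le> L"
    "\<And>t. t \<in> {0..T} \<Longrightarrow> x t = a t + u0 + integral {0..t} (\<lambda>s. \<pi> (h s - \<eta> s))"
    "\<And>t. t \<in> {0..T} \<Longrightarrow> \<pi> (x t - a t) = x t - a t"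
    "\<And>t z. t \<in> {0..T} \<Longrightarrow> \<phi> (x t) + \<eta> t \<bullet> (z - x t) \<le> \<phi> z"
proof -
  interpret \<pi>: bounded_linear \<pi> by (rule \<pi>(1))
  have "bounded (a ` {0..T})" by (intro compact_imp_bounded compact_continuous_image a) auto
  then obtain Ra where Ra: "0 < Ra" "\<And>t. t \<in> {0..T} \<Longrightarrow> norm (a t) \<le> Ra"
    by (auto simp: bounded_pos)
  obtain La where La: "\<And>x. norm x \<le> Ra \<Longrightarrow> norm (\<sigma> x) \<le> La" using bounded_on_balls[of Ra] by blast
  have La0: "0 \<le> La" using order_trans[OF norm_ge_zero La[of 0]] Ra by simp
  define C where "C = La * Ra"
  have C0: "0 \<le> C" using La0 Ra by (simp add: C_def)
  have \<phi>a: "\<phi> (a t) \<le> C" if "t \<in> {0..T}" for t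
    using Lipschitz_on_ball[OF La Ra(2)[OF that], of 0] mult_left_mono[OF Ra(2)[OF that] La0]
    by (simp add: zero C_def)
  have hi: "h integrable_on {0..T}" and hn: "(\<lambda>s. norm (h s)) integrable_on {0..T}"
    using h by (auto simp: absolutely_integrable_on_def)
  define B where "B = integral {0..T} (\<lambda>s. norm (h s))"
  have B0: "0 \<le> B" unfolding B_def by (intro integral_nonneg hn) auto
  \<comment> \<open>Every \<open>M\<close> with \<open>M\<^sup>2 \<le> |u0|\<^sup>2 + 2 C T + 2 B M\<close> is at most \<open>M0\<close>.\<close>
  define M0 where "M0 = (norm u0)\<^sup>2 + 2 * C * T + 2 * B + 1"
  define R where "R = Ra + M0"
  have M00: "0 < M0" using C0 B0 T by (simp add: M0_def add_nonneg_pos)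
  have R: "0 < R" using M00 Ra by (simp add: R_def)
  have \<pi>hi: "(\<lambda>s. \<pi> (h s)) integrable_on {0..T}" using integrable_linear[OF hi \<pi>(1)] by (simp add: o_def)
  define b where "b = (\<lambda>t. a t + u0 + integral {0..t} (\<lambda>s. \<pi> (h s)))"
  have bc: "continuous_on {0..T} b"
    unfolding b_def by (intro continuous_intros a indefinite_integral_continuous_1 \<pi>hi)
  obtain H \<eta> L where Hc: "continuous_on {0..T} H"
    and \<eta>: "\<And>t. t \<in> {0..T} \<Longrightarrow> (\<eta> has_integral H t) {0..t}"
    and \<eta>L: "\<And>t. t \<in> {0..T} \<Longrightarrow> norm (\<eta> t) \<le> L"
    and sg: "\<And>t z. t \<in> {0..T} \<Longrightarrow> \<phi> (retract_ball R (b t - \<pi> (H t))) + \<eta> t \<bullet> (z - retract_ball R (b t - \<pi> (H t))) \<le> \<phi> z"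
    by (rule truncated_inclusion[OF T bc \<pi>(1) R]) blast
  define x where "x = (\<lambda>t. b t - \<pi> (H t))"
  have xc: "continuous_on {0..T} x" unfolding x_def by (intro continuous_intros bc \<pi>.continuous_on Hc)
  have \<eta>i: "\<eta> integrable_on {0..T}" using \<eta>[of T] T by auto
  then have \<eta>ai: "\<eta> absolutely_integrable_on {0..T}"
    by (rule absolutely_integrable_integrable_bound[of "{0..T}" \<eta> "\<lambda>_. L", rotated 1]) (use \<eta>L in auto)
  define g where "g = (\<lambda>s. \<pi> (h s - \<eta> s))"
  have gai: "g absolutely_integrable_on {0..T}"
    using absolutely_integrable_linear[OF set_integral_diff(1)[OF h \<eta>ai] \<pi>(1)] by (simp add: g_def o_def)
  have sub_int: "f integrable_on {0..t}" if "f integrable_on {0..T}" "t \<in> {0..T}" for f :: "real \<Rightarrow> 'c::euclidean_space" and t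
    using that by (intro integrable_on_subinterval[OF that(1)]) auto
  have \<pi>\<eta>i: "(\<lambda>s. \<pi> (\<eta> s)) integrable_on {0..T}" using integrable_linear[OF \<eta>i \<pi>(1)] by (simp add: o_def)
  have xt: "x t = a t + (u0 + integral {0..t} g)" if t: "t \<in> {0..T}" for t
  proof -
    have "integral {0..t} g = integral {0..t} (\<lambda>s. \<pi> (h s) - \<pi> (\<eta> s))"
      by (simp add: g_def \<pi>.diff)
    also have "\<dots> = integral {0..t} (\<lambda>s. \<pi> (h s)) - integral {0..t} (\<lambda>s. \<pi> (\<eta> s))"
      by (rule Henstock_Kurzweil_Integration.integral_diff[OF sub_int[OF \<pi>hi t] sub_int[OF \<pi>\<eta>i t]])
    also have "integral {0..t} (\<lambda>s. \<pi> (\<eta> s)) = \<pi> (H t)"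
      using has_integral_linear[OF \<eta>[OF t] \<pi>(1)] by (simp add: o_def integral_unique)
    finally show ?thesis by (simp add: x_def b_def)
  qed
  define u where "u = (\<lambda>t. x t - a t)"
  have ut: "u t = u0 + integral {0..t} g" if "t \<in> {0..T}" for t using xt[OF that] by (simp add: u_def)
  have \<pi>u: "\<pi> (u t) = u t" if t: "t \<in> {0..T}" for t
  proof -
    have "\<pi> (integral {0..t} g) = integral {0..t} (\<lambda>s. \<pi> (g s))"
      using integral_linear[OF sub_int[OF set_lebesgue_integral_eq_integral(1)[OF gai] t] \<pi>(1)] by (simp add: o_def)
    then show ?thesis by (simp add: ut[OF t] \<pi>.add \<pi>u0) (simp add: g_def \<pi>(2))
  qed
  have uc: "continuous_on {0..T} u" unfolding u_def by (intro continuous_intros xc a)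
  obtain t0 where t0: "t0 \<in> {0..T}" "\<And>t. t \<in> {0..T} \<Longrightarrow> norm (u t) \<le> norm (u t0)"
    using continuous_attains_sup[of "{0..T}" "\<lambda>t. norm (u t)"] T continuous_on_norm[OF uc] by auto
  define M where "M = norm (u t0)"
  have dissip: "u s \<bullet> g s \<le> M * norm (h s) + C" if s: "s \<in> {0..T}" for s
  proof -
    let ?P = "retract_ball R (x s)"
    have "0 \<le> \<phi> ?P" by (rule nonneg)
    have "\<phi> ?P \<le> \<eta> s \<bullet> ?P" using sg[OF s, of 0] by (simp add: x_def zero inner_diff_right)
    have "\<eta> s \<bullet> ?P \<le> \<eta> s \<bullet> x s"
    proof -
      have k: "0 < R / max R (norm (x s))" "R / max R (norm (x s)) \<le> 1" using R by (auto simp: divide_le_eq)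
      have eq: "\<eta> s \<bullet> ?P = R / max R (norm (x s)) * (\<eta> s \<bullet> x s)" by (simp add: retract_ball_def)
      have "0 \<le> \<eta> s \<bullet> ?P" using \<open>0 \<le> \<phi> ?P\<close> \<open>\<phi> ?P \<le> \<eta> s \<bullet> ?P\<close> by simp
      then have "0 \<le> \<eta> s \<bullet> x s" using k(1) unfolding eq zero_le_mult_iff by linarith
      from mult_right_mono[OF k(2) this] show ?thesis by (simp add: eq)
    qed
    moreover have "\<eta> s \<bullet> (a s - ?P) \<le> C"
      using sg[OF s, of "a s"] \<phi>a[OF s] \<open>0 \<le> \<phi> ?P\<close> by (simp add: x_def)
    ultimately have "- C \<le> \<eta> s \<bullet> u s" by (simp add: u_def inner_diff_right)
    moreover have "u s \<bullet> g s = u s \<bullet> h s - \<eta> s \<bullet> u s"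
      using \<pi>(3)[of "u s" "h s - \<eta> s"] by (simp add: g_def \<pi>u[OF s] inner_diff_right inner_commute)
    moreover have "u s \<bullet> h s \<le> M * norm (h s)"
      by (rule order_trans[OF norm_cauchy_schwarz]) (use t0(2)[OF s] in \<open>auto simp: M_def intro: mult_right_mono\<close>)
    ultimately show ?thesis by linarith
  qed
  have gai0: "g absolutely_integrable_on {0..t0}"
    using t0(1) by (intro absolutely_integrable_on_subinterval[OF gai]) auto
  have kI: "((\<lambda>s. M * norm (h s) + C) has_integral M * B + C * T) {0..T}"
    using has_integral_add[OF has_integral_mult_right[OF integrable_integral[OF hn], of M]
        has_integral_const_real[of C 0 T]] T by (simp add: B_def mult.commute)
  then have ki: "(\<lambda>s. M * norm (h s) + C) integrable_on {0..T}" by blast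
  note sq = norm_square_primitive[OF gai0, of u u0]
  have "M\<^sup>2 = (norm u0)\<^sup>2 + 2 * integral {0..t0} (\<lambda>s. u s \<bullet> g s)"
    unfolding M_def using t0(1) by (intro sq(2)) (auto intro!: ut)
  also have "integral {0..t0} (\<lambda>s. u s \<bullet> g s) \<le> integral {0..t0} (\<lambda>s. M * norm (h s) + C)"
  proof (rule integral_le)
    show "(\<lambda>s. u s \<bullet> g s) integrable_on {0..t0}"
      using t0(1) by (intro set_lebesgue_integral_eq_integral(1) sq(1)) (auto intro!: ut)
    show "(\<lambda>s. M * norm (h s) + C) integrable_on {0..t0}" by (rule sub_int[OF ki t0(1)])
  qed (use t0(1) in \<open>auto intro!: dissip\<close>)
  also have "\<dots> \<le> integral {0..T} (\<lambda>s. M * norm (h s) + C)"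
    using t0(1) C0 by (intro integral_subset_le sub_int[OF ki t0(1)] ki) (auto simp: M_def)
  also have "\<dots> = M * B + C * T"
    by (rule integral_unique[OF kI])
  finally have M2: "M * M \<le> (norm u0)\<^sup>2 + 2 * C * T + 2 * B * M" by (simp add: power2_eq_square algebra_simps)
  have MM0: "M \<le> M0"
  proof (cases "M \<le> 1")
    case True
    then show ?thesis using C0 B0 T by (simp add: M0_def add_increasing)
  next
    case False
    have "(norm u0)\<^sup>2 + 2 * C * T \<le> ((norm u0)\<^sup>2 + 2 * C * T) * M"
      using False C0 T mult_left_mono[of 1 M "(norm u0)\<^sup>2 + 2 * C * T"] by simp
    with M2 have "M * M \<le> ((norm u0)\<^sup>2 + 2 * C * T + 2 * B) * M" by (simp add: algebra_simps)
    then show ?thesis using False by (simp add: M0_def)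
  qed
  have retr: "retract_ball R (b t - \<pi> (H t)) = x t" if t: "t \<in> {0..T}" for t
  proof -
    have "norm (x t) \<le> norm (a t) + norm (u t)" using norm_triangle_ineq[of "a t" "u t"] by (simp add: u_def)
    also have "\<dots> \<le> R" using Ra(2)[OF t] t0(2)[OF t] MM0 by (simp add: R_def M_def)
    finally have "retract_ball R (x t) = x t" by (rule retract_ball_id[OF R])
    then show ?thesis by (simp add: x_def)
  qed
  show ?thesis
    by (rule that[OF xc \<eta>ai \<eta>L]) (use sg retr xt \<pi>u in \<open>auto simp: g_def u_def\<close>)
qed

end

section \<open>Subgradients of the hypergraph energy\<close>

text \<open>
  The tangent inequality for \<open>r\<^sup>p / p\<close>. At \<open>f = 0\<close> the slope is \<open>0 powr (p - 1) = 0\<close>, also for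
  \<open>p = 1\<close>, where 0 is one of the subgradients.
\<close>

lemma powr_tangent:
  fixes p r f :: real
  assumes p: "1 \<le> p" and r: "0 \<le> r" and f: "0 \<le> f"
  shows "f powr p / p + f powr (p - 1) * (r - f) \<le> r powr p / p"
proof (cases "f = 0 \<or> r = 0")
  case True
  then show ?thesis
  proof
    assume "r = 0"
    have "f powr (p - 1) * f = f powr p"
      using f by (cases "f = 0") (simp_all add: powr_mult_base mult.commute)
    moreover have "f powr p / p \<le> f powr p" using p by (simp add: divide_le_eq mult_le_cancel_left1)
    ultimately show ?thesis using \<open>r = 0\<close> by simp
  qed (use p in auto)
next
  case False
  then have pos: "0 < f" "0 < r" using r f by auto
  have "f powr (p - 1) * p * (r - f) \<le> r powr p - f powr p"
  proof (rule convex_on_imp_above_tangent[of "{0<..}"])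
    show "convex_on {0<..} (\<lambda>x. x powr p)" by (rule powr_convex[OF p])
    show "((\<lambda>x. x powr p) has_real_derivative f powr (p - 1) * p) (at f within {0<..})"
      using has_real_derivative_powr[OF pos(1), of p] by (simp add: mult.commute has_field_derivative_at_within)
    show "f \<in> interior {0<..}" using pos by (simp add: interior_open)
  qed (use pos in auto)
  then have "f powr (p - 1) * p * (r - f) / p \<le> (r powr p - f powr p) / p"
    using p by (intro divide_right_mono) auto
  then show ?thesis using p by (simp add: diff_divide_distrib)
qed

lemma edge_max_ge:
  assumes "u \<in> e" "v \<in> e"
  shows "x $ u - x $ v \<le> edge_max e x"
  unfolding edge_max_def
proof (rule Max_ge)
  have "{x $ u - x $ v |u v. u \<in> e \<and> v \<in> e} = (\<lambda>(u, v). x $ u - x $ v) ` (e \<times> e)" by auto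
  then show "finite {x $ u - x $ v |u v. u \<in> e \<and> v \<in> e}" by simp
qed (use assms in auto)

lemma edge_max_attained:
  assumes "e \<noteq> {}"
  obtains u v where "u \<in> e" "v \<in> e" "edge_max e x = x $ u - x $ v"
proof -
  have eq: "{x $ u - x $ v |u v. u \<in> e \<and> v \<in> e} = (\<lambda>(u, v). x $ u - x $ v) ` (e \<times> e)" by auto
  have "edge_max e x \<in> {x $ u - x $ v |u v. u \<in> e \<and> v \<in> e}"
    unfolding edge_max_def by (rule Max_in) (use assms in \<open>simp_all add: eq\<close>)
  then show ?thesis using that by auto
qed

lemma edge_max_nonneg: "e \<noteq> {} \<Longrightarrow> 0 \<le> edge_max e x"
  using edge_max_ge[of _ e _ x] by fastforce

text \<open>
  An explicit subgradient: in each edge a pair \<open>(u, v)\<close> of vertices at which \<open>edge_max e x\<close> is attained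
  contributes a multiple of the difference of the two unit vectors, as \<open>z $ u - z $ v\<close> is an affine
  minorant of \<open>edge_max e z\<close> that is exact at \<open>x\<close>.
\<close>

lemma energy_subgradient:
  fixes E :: "'v::finite set set"
  assumes hyp: "hypergraph E w" and p: "1 \<le> p"
  obtains \<sigma> :: "real ^ 'v \<Rightarrow> real ^ 'v"
  where "\<And>x z. energy p E w x + \<sigma> x \<bullet> (z - x) \<le> energy p E w z"
    and "\<And>R. \<exists>L. \<forall>x. norm x \<le> R \<longrightarrow> norm (\<sigma> x) \<le> L"
proof -
  have ne: "e \<noteq> {}" and w: "0 < w e" if "e \<in> E" for e
    using hyp that by (auto simp: hypergraph_def)
  have "\<forall>e\<in>E. \<forall>x :: real ^ 'v. \<exists>q. fst q \<in> e \<and> snd q \<in> e \<and> edge_max e x = x $ fst q - x $ snd q"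
    using edge_max_attained[OF ne] by (metis fst_conv snd_conv)
  then obtain q where q: "\<And>e x :: real ^ 'v. e \<in> E \<Longrightarrow> fst (q e x) \<in> e \<and> snd (q e x) \<in> e \<and>
      edge_max e x = x $ fst (q e x) - x $ snd (q e x)"
    by metis
  \<comment> \<open>The gradient of \<open>z $ u - z $ v\<close> for the chosen maximising pair \<open>(u, v) = q e x\<close>.\<close>
  define D where "D = (\<lambda>e x. axis (fst (q e x)) 1 - axis (snd (q e x)) 1 :: real ^ 'v)"
  have D: "D e x \<bullet> z = z $ fst (q e x) - z $ snd (q e x)" for e x z
    by (simp add: D_def inner_diff_left inner_axis' )
  define \<sigma> where "\<sigma> = (\<lambda>x. \<Sum>e\<in>E. (w e * edge_max e x powr (p - 1)) *\<^sub>R D e x)"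
  show ?thesis
  proof (rule that[of \<sigma>])
    fix x z :: "real ^ 'v"
    have edge: "w e * edge_max e x powr p / p + w e * edge_max e x powr (p - 1) * (D e x \<bullet> (z - x))
        \<le> w e * edge_max e z powr p / p" if e: "e \<in> E" for e
    proof -
      have "D e x \<bullet> (z - x) \<le> edge_max e z - edge_max e x"
        using q[OF e, of x] edge_max_ge[of "fst (q e x)" e "snd (q e x)" z] by (simp add: D)
      then have "edge_max e x powr p / p + edge_max e x powr (p - 1) * (D e x \<bullet> (z - x))
          \<le> edge_max e x powr p / p + edge_max e x powr (p - 1) * (edge_max e z - edge_max e x)"
        by (intro add_left_mono mult_left_mono) auto
      also have "\<dots> \<le> edge_max e z powr p / p"
        by (intro powr_tangent p edge_max_nonneg ne e)
      finally show ?thesis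
        using mult_left_mono[OF _ less_imp_le[OF w[OF e]]] by (fastforce simp: algebra_simps)
    qed
    have "energy p E w x + \<sigma> x \<bullet> (z - x) = (\<Sum>e\<in>E. w e * edge_max e x powr p / p +
        w e * edge_max e x powr (p - 1) * (D e x \<bullet> (z - x)))"
      by (simp add: energy_def \<sigma>_def inner_sum_left sum.distrib sum_divide_distrib)
    also have "\<dots> \<le> (\<Sum>e\<in>E. w e * edge_max e z powr p / p)" by (intro sum_mono edge)
    also have "\<dots> = energy p E w z" by (simp add: energy_def sum_divide_distrib)
    finally show "energy p E w x + \<sigma> x \<bullet> (z - x) \<le> energy p E w z" .
  next
    fix R :: real
    have "norm (\<sigma> x) \<le> (\<Sum>e\<in>E. w e * (2 * R) powr (p - 1) * 2)" if x: "norm x \<le> R" for x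
      unfolding \<sigma>_def
    proof (rule sum_norm_le)
      fix e assume e: "e \<in> E"
      have R: "0 \<le> R" using order_trans[OF norm_ge_zero x] .
      have "norm (D e x) \<le> 2"
        using norm_triangle_ineq4[of "axis (fst (q e x)) 1 :: real ^ 'v" "axis (snd (q e x)) 1"] by (simp add: D_def)
      moreover have "edge_max e x powr (p - 1) \<le> (2 * R) powr (p - 1)"
      proof (rule powr_mono2)
        show "edge_max e x \<le> 2 * R"
          using q[OF e, of x] component_le_norm_cart[of x "fst (q e x)"] component_le_norm_cart[of x "snd (q e x)"] x by linarith
      qed (use p edge_max_nonneg[OF ne[OF e]] in auto)
      ultimately have "w e * edge_max e x powr (p - 1) * norm (D e x) \<le> w e * (2 * R) powr (p - 1) * 2"
        using w[OF e] by (intro mult_mono mult_left_mono) auto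
      then show "norm ((w e * edge_max e x powr (p - 1)) *\<^sub>R D e x) \<le> w e * (2 * R) powr (p - 1) * 2"
        using w[OF e] by (simp add: abs_mult)
    qed
    then show "\<exists>L. \<forall>x. norm x \<le> R \<longrightarrow> norm (\<sigma> x) \<le> L" by blast
  qed
qed

lemma energy_nonneg: "hypergraph E w \<Longrightarrow> 1 \<le> p \<Longrightarrow> 0 \<le> energy p E w x"
  unfolding energy_def hypergraph_def
  by (intro mult_nonneg_nonneg sum_nonneg) (auto intro: less_imp_le)

lemma energy_zero: "hypergraph E w \<Longrightarrow> energy p E w 0 = 0"
proof -
  assume "hypergraph E w"
  then have "e \<noteq> {}" if "e \<in> E" for e using that by (auto simp: hypergraph_def)
  then have "edge_max e (0 :: real ^ 'a) = 0" if "e \<in> E" for e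
    using that edge_max_attained[of e "0 :: real ^ 'a"] by (metis diff_zero zero_index)
  then show ?thesis by (simp add: energy_def)
qed

section \<open>Square-integrable functions\<close>

lemma L2_space_bounded_linear:
  fixes f :: "real \<Rightarrow> 'a::euclidean_space" and A :: "'a \<Rightarrow> 'b::euclidean_space"
  assumes f: "f \<in> L2_space T" and A: "bounded_linear A"
  shows "(\<lambda>t. A (f t)) \<in> L2_space T"
proof -
  let ?M = "lebesgue_on {0<..<T}"
  have fm: "f \<in> borel_measurable ?M" and fi: "integrable ?M (\<lambda>t. (norm (f t))\<^sup>2)"
    using f by (auto simp: L2_space_def)
  have Am: "(\<lambda>t. A (f t)) \<in> borel_measurable ?M"
    using measurable_compose[OF fm borel_measurable_continuous_onI[OF linear_continuous_on[OF A]]] .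
  obtain K where K: "\<And>x. norm (A x) \<le> norm x * K" using A bounded_linear.bounded by blast
  have "(norm (A x))\<^sup>2 \<le> K\<^sup>2 * (norm x)\<^sup>2" for x
    using power_mono[OF K[of x], of 2] by (simp add: power_mult_distrib mult.commute)
  then have "integrable ?M (\<lambda>t. (norm (A (f t)))\<^sup>2)"
    using Am by (intro Bochner_Integration.integrable_bound[OF integrable_mult_right[OF fi, of "K\<^sup>2"]]) auto
  with Am show ?thesis by (simp add: L2_space_def)
qed

lemma L2_space_add:
  fixes f g :: "real \<Rightarrow> 'a::euclidean_space"
  assumes f: "f \<in> L2_space T" and g: "g \<in> L2_space T"
  shows "(\<lambda>t. f t + g t) \<in> L2_space T"
proof -
  let ?M = "lebesgue_on {0<..<T}"
  have m: "f \<in> borel_measurable ?M" "g \<in> borel_measurable ?M"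
    and i: "integrable ?M (\<lambda>t. (norm (f t))\<^sup>2)" "integrable ?M (\<lambda>t. (norm (g t))\<^sup>2)"
    using f g by (auto simp: L2_space_def)
  have "(norm (x + y))\<^sup>2 \<le> 2 * (norm x)\<^sup>2 + 2 * (norm y)\<^sup>2" for x y :: 'a
    using power_mono[OF norm_triangle_ineq[of x y], of 2] sum_squares_bound[of "norm x" "norm y"]
    by (simp add: power2_sum)
  then have "integrable ?M (\<lambda>t. (norm (f t + g t))\<^sup>2)"
    using m by (intro Bochner_Integration.integrable_bound[OF Bochner_Integration.integrable_add[OF
          integrable_mult_right[OF i(1), of 2] integrable_mult_right[OF i(2), of 2]]]) auto
  with m show ?thesis by (simp add: L2_space_def)
qed

lemma L2_space_diff:
  fixes f g :: "real \<Rightarrow> 'a::euclidean_space"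
  assumes f: "f \<in> L2_space T" and g: "g \<in> L2_space T"
  shows "(\<lambda>t. f t - g t) \<in> L2_space T"
  using L2_space_add[OF f L2_space_bounded_linear[OF g bounded_linear_minus[OF bounded_linear_ident]]] by simp

lemma L2_space_bounded:
  fixes f :: "real \<Rightarrow> 'a::euclidean_space"
  assumes f: "f absolutely_integrable_on {0..T}" and L: "\<And>t. t \<in> {0..T} \<Longrightarrow> norm (f t) \<le> L"
  shows "f \<in> L2_space T"
proof -
  let ?M = "lebesgue_on {0<..<T}"
  interpret M: finite_measure ?M by (rule finite_measure_lebesgue_on) auto
  have "integrable ?M f"
    using f[unfolded absolutely_integrable_on_Icc_iff_Ioo] by (simp add: set_integrable_def integrable_restrict_space)
  then have m: "f \<in> borel_measurable ?M" by (rule borel_measurable_integrable)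
  have "(norm (f t))\<^sup>2 \<le> L\<^sup>2" if "t \<in> {0<..<T}" for t
    using power_mono[OF L[of t], of 2] that by simp
  then have "integrable ?M (\<lambda>t. (norm (f t))\<^sup>2)"
    using m by (intro Bochner_Integration.integrable_bound[OF M.integrable_const[of "L\<^sup>2"]]) (auto intro!: AE_I2)
  with m show ?thesis by (simp add: L2_space_def)
qed

lemma L2_space_continuous:
  fixes f :: "real \<Rightarrow> 'a::euclidean_space"
  assumes f: "continuous_on {0..T} f"
  shows "f \<in> L2_space T"
proof -
  have "bounded (f ` {0..T})" by (intro compact_imp_bounded compact_continuous_image f) auto
  then obtain L where "\<And>t. t \<in> {0..T} \<Longrightarrow> norm (f t) \<le> L" by (force simp: bounded_iff)
  then show ?thesis by (intro L2_space_bounded absolutely_integrable_continuous_real f)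
qed

section \<open>The constraint sets and their normal vectors\<close>

text \<open>
  The orthogonal projection that keeps the free components and sets the prescribed ones to 0. The set
  \<open>constraint_set a t\<close> is the translate by \<open>a t\<close> of its range.
\<close>

definition free_part :: "real ^ ('n::finite + 'm::finite) \<Rightarrow> real ^ ('n + 'm)" where
  "free_part x = (\<chi> v. case v of Inl i \<Rightarrow> x $ v | Inr j \<Rightarrow> 0)"

lemma free_part_nth [simp]: "free_part x $ Inl i = x $ Inl i" "free_part x $ Inr j = 0"
  by (simp_all add: free_part_def)

lemma vec_sum_eq_iff: "x = y \<longleftrightarrow> (\<forall>i. x $ Inl i = y $ Inl i) \<and> (\<forall>j. x $ Inr j = y $ Inr j)"
  by (metis sumE vec_eq_iff)

lemma bounded_linear_free_part: "bounded_linear (free_part :: real ^ ('n::finite + 'm::finite) \<Rightarrow> _)"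
  unfolding linear_conv_bounded_linear[symmetric] by (rule linearI) (simp_all add: vec_sum_eq_iff)

lemma free_part_idem: "free_part (free_part x) = free_part x"
  by (simp add: vec_sum_eq_iff)

lemma free_part_inner: "free_part x \<bullet> y = x \<bullet> free_part y"
  unfolding inner_vec_def by (intro sum.cong) (auto simp: free_part_def split: sum.split)

lemma free_part_eq_0_iff: "free_part x = 0 \<longleftrightarrow> (\<forall>i. x $ Inl i = 0)"
  by (simp add: vec_sum_eq_iff)

lemma free_part_eq_self_iff: "free_part x = x \<longleftrightarrow> (\<forall>j. x $ Inr j = 0)"
  by (auto simp: vec_sum_eq_iff)

lemma constraint_set_iff: "x \<in> constraint_set a t \<longleftrightarrow> free_part (x - a t) = x - a t"
  by (simp add: constraint_set_def free_part_eq_self_iff)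

lemma subdifferential_ereal:
  "\<eta> \<in> subdifferential (\<lambda>z. ereal (f z)) x \<longleftrightarrow> (\<forall>z. f x + \<eta> \<bullet> (z - x) \<le> f z)"
  by (auto simp: subdifferential_def algebra_simps)

text \<open>
  The vectors in the kernel of the projection are normal to the constraint set.
\<close>

lemma subdifferential_indicator_constraintI:
  assumes x: "x \<in> constraint_set a t" and \<xi>: "free_part \<xi> = 0"
  shows "\<xi> \<in> subdifferential (convex_indicator (constraint_set a t)) x"
proof -
  have "\<xi> \<bullet> (z - x) = 0" if "z \<in> constraint_set a t" for z
  proof -
    have "free_part (z - x) = z - x"
      using x that by (simp add: constraint_set_def free_part_eq_self_iff)
    then show ?thesis using free_part_inner[of \<xi> "z - x"] \<xi> by simp
  qed
  then show ?thesis using x by (auto simp: subdifferential_def convex_indicator_def)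
qed

lemma subdifferential_indicatorD:
  assumes "\<xi> \<in> subdifferential (convex_indicator K) x"
  shows "x \<in> K" "\<And>z. z \<in> K \<Longrightarrow> \<xi> \<bullet> (z - x) \<le> 0"
proof -
  show x: "x \<in> K" using assms by (auto simp: subdifferential_def convex_indicator_def split: if_splits)
  fix z assume z: "z \<in> K"
  have "ereal (\<xi> \<bullet> (z - x)) \<le> convex_indicator K z - convex_indicator K x"
    using assms by (auto simp: subdifferential_def split: if_splits)
  then show "\<xi> \<bullet> (z - x) \<le> 0" using x z by (simp add: convex_indicator_def)
qed

section \<open>Uniqueness and existence\<close>

text \<open>
  The difference \<open>d\<close> of two solutions satisfies \<open>d \<bullet> d' \<le> 0\<close> almost everywhere by monotonicity of both
  subdifferentials; hence \<open>|d|\<^sup>2\<close>, the primitive of \<open>2 d \<bullet> d'\<close>, vanishes.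
\<close>

lemma is_solution_unique:
  assumes T: "0 < T" and y1: "is_solution p E w T a h x0 y1" and y2: "is_solution p E w T a h x0 y2"
    and t: "t \<in> {0..T}"
  shows "y1 t = y2 t"
proof -
  let ?S = "\<lambda>y y' t. \<exists>\<eta>\<in>subdifferential (\<lambda>z. ereal (energy p E w z)) (y t).
           \<exists>\<xi>\<in>subdifferential (convex_indicator (constraint_set a t)) (y t). y' t + \<eta> + \<xi> = h t"
  obtain y1' where y1': "y1' \<in> L2_space T" "weak_derivative T y1 y1'"
    and S1: "AE t in lebesgue_on {0..T}. ?S y1 y1' t"
    using y1 by (auto simp: is_solution_def)
  obtain y2' where y2': "y2' \<in> L2_space T" "weak_derivative T y2 y2'"
    and S2: "AE t in lebesgue_on {0..T}. ?S y2 y2' t"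
    using y2 by (auto simp: is_solution_def)
  have c: "continuous_on {0..T} y1" "continuous_on {0..T} y2" and y0: "y1 0 = x0" "y2 0 = x0"
    using y1 y2 by (auto simp: is_solution_def W12_space_def)
  note ai = L2_space_imp_absolutely_integrable[OF y1'(1)] L2_space_imp_absolutely_integrable[OF y2'(1)]
  define d where "d = (\<lambda>t. y1 t - y2 t)"
  define d' where "d' = (\<lambda>t. y1' t - y2' t)"
  have d'ai: "d' absolutely_integrable_on {0..T}" unfolding d'_def by (rule set_integral_diff(1)[OF ai])
  have d: "d s = 0 + integral {0..s} d'" if s: "s \<in> {0..T}" for s
  proof -
    have sub: "{0..s} \<subseteq> {0..T}" using s by auto
    have "integral {0..s} d' = integral {0..s} y1' - integral {0..s} y2'"
      unfolding d'_def
      by (intro Henstock_Kurzweil_Integration.integral_diff integrable_on_subinterval[OF _ sub]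
          set_lebesgue_integral_eq_integral(1) ai)
    then show ?thesis
      using weak_derivative_imp_primitive[OF c(1) ai(1) T y1'(2) s]
        weak_derivative_imp_primitive[OF c(2) ai(2) T y2'(2) s] y0 by (simp add: d_def)
  qed
  have mono: "AE s in lebesgue_on {0..T}. d s \<bullet> d' s \<le> 0"
    using S1 S2
  proof eventually_elim
    case (elim s)
    from elim(1) obtain \<eta>1 \<xi>1 where 1: "\<eta>1 \<in> subdifferential (\<lambda>z. ereal (energy p E w z)) (y1 s)"
      "\<xi>1 \<in> subdifferential (convex_indicator (constraint_set a s)) (y1 s)" "y1' s + \<eta>1 + \<xi>1 = h s" by auto
    from elim(2) obtain \<eta>2 \<xi>2 where 2: "\<eta>2 \<in> subdifferential (\<lambda>z. ereal (energy p E w z)) (y2 s)"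
      "\<xi>2 \<in> subdifferential (convex_indicator (constraint_set a s)) (y2 s)" "y2' s + \<eta>2 + \<xi>2 = h s" by auto
    have "\<eta>1 \<bullet> (y2 s - y1 s) + \<eta>2 \<bullet> (y1 s - y2 s) \<le> 0"
      using 1(1) 2(1) unfolding subdifferential_ereal by (smt (verit, best))
    moreover have "\<xi>1 \<bullet> (y2 s - y1 s) + \<xi>2 \<bullet> (y1 s - y2 s) \<le> 0"
      using subdifferential_indicatorD[OF 1(2)] subdifferential_indicatorD[OF 2(2)] by (simp add: add_nonpos_nonpos)
    moreover have "d' s = (\<eta>2 - \<eta>1) + (\<xi>2 - \<xi>1)"
      using 1(3) 2(3) by (simp add: d'_def algebra_simps)
    ultimately show ?case
      by (simp add: d_def inner_diff_left inner_diff_right inner_add_right inner_commute)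
  qed
  have sub: "{0..t} \<subseteq> {0..T}" using t by auto
  have d'ai': "d' absolutely_integrable_on {0..t}" by (rule absolutely_integrable_on_subinterval[OF d'ai sub])
  have t0: "0 \<le> t" using t by simp
  have dt: "d s = 0 + integral {0..s} d'" if "s \<in> {0..t}" for s using d that t by auto
  note sq = norm_square_primitive[OF d'ai' t0 dt]
  have int: "integrable (lebesgue_on {0..t}) (\<lambda>s. d s \<bullet> d' s)"
    using sq(1) by (simp add: set_integrable_def integrable_restrict_space)
  have "AE s in lebesgue_on {0..t}. d s \<bullet> d' s \<le> 0"
    using mono sub by (simp add: AE_restrict_space_iff) (auto elim!: eventually_mono)
  then have "AE s in lebesgue_on {0..t}. 0 \<le> - (d s \<bullet> d' s)" by simp
  from integral_nonneg_AE[OF this] have "integral\<^sup>L (lebesgue_on {0..t}) (\<lambda>s. d s \<bullet> d' s) \<le> 0" by simp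
  then have "integral {0..t} (\<lambda>s. d s \<bullet> d' s) \<le> 0" using lebesgue_integral_eq_integral[OF int] by simp
  then have "(norm (d t))\<^sup>2 \<le> 0" using sq(2) by simp
  then show ?thesis by (simp add: d_def)
qed

lemma is_solution_exists:
  fixes E :: "('n::finite + 'm::finite) set set"
  assumes E: "hypergraph E w" and p: "1 \<le> p" and T: "0 < T"
    and a: "a \<in> W12_space T" and a0: "\<forall>t\<in>{0..T}. \<forall>i. a t $ Inl i = 0"
    and x0: "x0 \<in> constraint_set a 0" and h: "h \<in> L2_space T"
  obtains x where "is_solution p E w T a h x0 x"
proof -
  let ?\<pi> = "free_part :: real ^ ('n + 'm) \<Rightarrow> _"
  interpret \<pi>: bounded_linear ?\<pi> by (rule bounded_linear_free_part)
  obtain \<sigma> :: "real ^ ('n + 'm) \<Rightarrow> real ^ ('n + 'm)" where \<sigma>: "\<And>x z. energy p E w x + \<sigma> x \<bullet> (z - x) \<le> energy p E w z"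
    "\<And>R. \<exists>L. \<forall>x. norm x \<le> R \<longrightarrow> norm (\<sigma> x) \<le> L"
    using energy_subgradient[OF E p] by metis
  interpret S: subgradient_selection "energy p E w" \<sigma>
    by unfold_locales (use \<sigma> energy_nonneg[OF E p] energy_zero[OF E] in auto)
  obtain a' where a': "a' \<in> L2_space T" "weak_derivative T a a'" and ac: "continuous_on {0..T} a"
    using a by (auto simp: W12_space_def)
  have \<pi>a: "?\<pi> (a t) = 0" if "t \<in> {0..T}" for t using a0 that by (simp add: free_part_eq_0_iff)
  obtain x \<eta> L where xc: "continuous_on {0..T} x"
    and \<eta>: "\<eta> absolutely_integrable_on {0..T}" "\<And>t. t \<in> {0..T} \<Longrightarrow> norm (\<eta> t) \<le> L"
    and x: "\<And>t. t \<in> {0..T} \<Longrightarrow> x t = a t + (x0 - a 0) + integral {0..t} (\<lambda>s. ?\<pi> (h s - \<eta> s))"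
    and xK: "\<And>t. t \<in> {0..T} \<Longrightarrow> ?\<pi> (x t - a t) = x t - a t"
    and sg: "\<And>t z. t \<in> {0..T} \<Longrightarrow> energy p E w (x t) + \<eta> t \<bullet> (z - x t) \<le> energy p E w z"
    by (rule S.gradient_flow_exists[OF T ac L2_space_imp_absolutely_integrable[OF h]
      bounded_linear_free_part free_part_idem free_part_inner \<pi>a x0[unfolded constraint_set_iff]]) blast+
  \<comment> \<open>\<open>b\<close> is the weak derivative of \<open>a\<close> with values in the kernel of the projection at every \<open>t\<close>; for
      \<open>a'\<close> itself this holds only almost everywhere.\<close>
  define b where "b = (\<lambda>t. a' t - ?\<pi> (a' t))"
  define g where "g = (\<lambda>t. ?\<pi> (h t - \<eta> t))"
  have L2: "b \<in> L2_space T" "g \<in> L2_space T"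
    unfolding b_def g_def
    by (intro L2_space_diff L2_space_bounded_linear[OF _ bounded_linear_free_part] a' h L2_space_bounded[OF \<eta>]; assumption)+
  note ai = L2[THEN L2_space_imp_absolutely_integrable]
  define x' where "x' = (\<lambda>t. b t + g t)"
  have x'L2: "x' \<in> L2_space T" unfolding x'_def by (rule L2_space_add[OF L2])
  have prim: "x t = x 0 + integral {0..t} x'" if t: "t \<in> {0..T}" for t
  proof -
    have sub: "{0..t} \<subseteq> {0..T}" using t by auto
    have i: "b integrable_on {0..t}" "g integrable_on {0..t}" "a' integrable_on {0..t}"
      by (intro integrable_on_subinterval[OF _ sub] set_lebesgue_integral_eq_integral(1) ai
          L2_space_imp_absolutely_integrable[OF a'(1)])+
    have A: "integral {0..t} a' = a t - a 0"
      using weak_derivative_imp_primitive[OF ac L2_space_imp_absolutely_integrable[OF a'(1)] T a'(2) t] by simp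
    have "integral {0..t} b = integral {0..t} a' - integral {0..t} (?\<pi> \<circ> a')"
      unfolding b_def o_def using integrable_linear[OF i(3) bounded_linear_free_part]
      by (intro Henstock_Kurzweil_Integration.integral_diff i) (simp add: o_def)
    also have "integral {0..t} (?\<pi> \<circ> a') = ?\<pi> (integral {0..t} a')"
      by (rule integral_linear[OF i(3) bounded_linear_free_part])
    also have "\<dots> = 0" using \<pi>a[OF t] \<pi>a[of 0] T by (simp add: A \<pi>.diff)
    finally have "integral {0..t} x' = a t - a 0 + integral {0..t} g"
      unfolding x'_def using i by (simp add: A Henstock_Kurzweil_Integration.integral_add)
    moreover have "x 0 = x0" using x[of 0] T by simp
    ultimately show ?thesis using x[OF t] by (simp add: g_def)
  qed
  have wd: "weak_derivative T x x'"
    by (rule weak_derivative_primitive[OF L2_space_imp_absolutely_integrable[OF x'L2] T prim])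
  have "is_solution p E w T a h x0 x"
    unfolding is_solution_def
  proof (intro conjI bexI[OF _ x'L2] AE_I2)
    show "x \<in> W12_space T"
      unfolding W12_space_def using L2_space_continuous[OF xc] xc x'L2 wd by blast
    show "x 0 = x0" using x[of 0] T by simp
    fix t assume "t \<in> space (lebesgue_on {0..T})"
    then have t: "t \<in> {0..T}" by simp
    have "\<eta> t \<in> subdifferential (\<lambda>z. ereal (energy p E w z)) (x t)"
      using sg[OF t] by (simp add: subdifferential_ereal)
    \<comment> \<open>This vector equals \<open>(h - \<eta>) - \<pi> (h - \<eta>) - b\<close>, which lies in the kernel of the projection.\<close>
    moreover have "h t - x' t - \<eta> t \<in> subdifferential (convex_indicator (constraint_set a t)) (x t)"
      using xK[OF t]
      by (intro subdifferential_indicator_constraintI)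
         (simp_all add: constraint_set_iff x'_def b_def g_def \<pi>.diff \<pi>.add free_part_idem)
    ultimately show "\<exists>\<eta>\<in>subdifferential (\<lambda>z. ereal (energy p E w z)) (x t).
           \<exists>\<xi>\<in>subdifferential (convex_indicator (constraint_set a t)) (x t). x' t + \<eta> + \<xi> = h t"
      by (intro bexI[of _ "\<eta> t"] bexI[of _ "h t - x' t - \<eta> t"]) simp_all
  qed (rule wd)
  then show ?thesis by (rule that)
qed

theorem theorem3p1:
  fixes E :: "('n::finite + 'm::finite) set set"
    and w :: "('n + 'm) set \<Rightarrow> real"
    and p T :: real
    and a h :: "real \<Rightarrow> real ^ ('n + 'm)"
    and x0 :: "real ^ ('n + 'm)"
  assumes "hypergraph E w"
    and "connected_hypergraph E"
    and "1 \<le> p"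
    and "0 < T"
    and "a \<in> W12_space T"
    and "\<forall>t\<in>{0..T}. \<forall>i. a t $ Inl i = 0"
    and "x0 \<in> constraint_set a 0"
    and "h \<in> L2_space T"
  shows "\<exists>x. is_solution p E w T a h x0 x \<and>
             (\<forall>y. is_solution p E w T a h x0 y \<longrightarrow> (\<forall>t\<in>{0..T}. y t = x t))"
proof -
  obtain x where "is_solution p E w T a h x0 x"
    using is_solution_exists[OF assms(1,3-8)] by blast
  with is_solution_unique[OF assms(4)] show ?thesis by blast
qed

end
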